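(* Let ${\mathcal G}=(B\cup W,E)$ be a finite bipartite graph embedded in the plane with vertex multiplicities $\mathbf n$, a choice of cilia and a connection $\Phi$. Suppose given, for each vertex $v$, a weighted bipartite graph (gadget) $\Gamma_v$ with an ordered list of distinguished boundary vertices, and a real matrix $M_v$, as follows. (i) For a white vertex $w$ with neighbors $b_1,\dots,b_d$ in edge order at $w$: $\Gamma_w$ has $dn_w$ boundary vertices, split into consecutive blocks of size $n_w$, the $i$-th block associated to the edge $b_iw$; $M_w=[M_{b_1w}\,|\cdots|\,M_{b_dw}]$ is an $n_w\times dn_w$ matrix with $n_w\times n_w$ blocks. (ii) For a black vertex $b$ with neighbors $w_1,\dots,w_k$ in edge order at $b$: $\Gamma_b$ has $N_b=\sum_i n_{w_i}$ boundary vertices, split into consecutive blocks, the $i$-th of size $n_{w_i}$ and associated to the edge $bw_i$; $M_b$ is the $N_b\times n_b$ matrix whose $i$-th block of rows is an $n_{w_i}\times n_b$ matrix $\phi'_{bw_i}$, and $\phi_{bw}=M_{bw}\,\phi'_{bw}$ for every edge $bw$. (iii) For every black $b$ and every $n_b$-element set $I$ of boundary positions of $\Gamma_b$, the sum of weights of matchings of $\Gamma_b$ which cover every non-boundary vertex of $\Gamma_b$ exactly once and cover exactly the boundary vertices in $I$ equals the maximal minor $\Delta_I(M_b)$ (rows $I$ in increasing order); likewise for every white $w$ and $n_w$-element set $J$ of boundary positions of $\Gamma_w$, the corresponding sum equals $\Delta_J(M_w)$ (columns $J$ in increasing order). Let $\hat{\mathcal G}$ be the graph obtained from the disjoint union of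 the gadgets by joining, for every edge $bw$ of ${\mathcal G}$ and every $1\le i\le n_w$, the $i$-th vertex of the block of $\Gamma_b$ associated to $bw$ to the $i$-th vertex of the block of $\Gamma_w$ associated to $bw$ by a "middle edge" of weight $1$. For a dimer cover (perfect matching) $\pi$ of $\hat{\mathcal G}$, with weight $\mathrm{wt}(\pi)$ the product of its edge weights, let $m(\pi)_e$ be the number of middle edges over $e$ not used by $\pi$. Then for every $m\in\Omega_{\mathbf n}({\mathcal G})$, $$\sum_{\pi:\ m(\pi)=m}\mathrm{wt}(\pi)=\mathrm{Tr}_\Phi(m).$$
   Context: A vertex multiplicity is a function $\mathbf n:B\cup W\to\mathbb Z_{>0}$, $v\mapsto n_v$. An $\mathbf n$-multiweb is a function $m:E\to\mathbb Z_{\ge0}$ with $\sum_{u\sim v}m_{uv}=n_v$ for every vertex $v$; $\Omega_{\mathbf n}({\mathcal G})$ is the set of $\mathbf n$-multiwebs. A connection $\Phi=\{\phi_{bw}\}_{bw\in E}$ assigns to each edge $bw$ ($b$ black, $w$ white) a real $n_w\times n_b$ matrix $\phi_{bw}$. A choice of cilia assigns to each vertex $v$ a distinguished wedge between two cyclically consecutive incident edges; it determines a total order ("edge order") of the edges at $v$: at a black vertex, counterclockwise starting just after the cilium; at a white vertex, clockwise starting just after the cilium. Trace. Let $\mathcal C_v=\{1,\dots,n_v\}$. A coloring of $m\in\Omega_{\mathbf n}({\mathcal G})$ assigns to each edge $e=bw$ with $m_e>0$ subsets $S_e\subset\mathcal C_b$, $T_e\subset\mathcal C_w$ of size $m_e$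 such that at each black $b$ the sets $S_{bw}$ partition $\mathcal C_b$ and at each white $w$ the sets $T_{bw}$ partition $\mathcal C_w$. The sign $c_b$ is the signature of the permutation of $\mathcal C_b$ obtained by listing the sets $S_{bw}$ in the edge order at $b$, each in increasing order; $c_w$ is defined likewise with the sets $T_{bw}$ in the edge order at $w$. Then $\mathrm{Tr}_\Phi(m)=\sum_C\prod_v c_v\prod_{e=bw:\,m_e>0}\det[(\phi_{bw})_{T_e,S_e}]$, summing over colorings $C$, where $(\phi)_{T,S}$ is the submatrix with rows $T$ and columns $S$ in increasing order. *)

theory Defs
  imports "Jordan_Normal_Form.Determinant" "Jordan_Normal_Form.DL_Submatrix"
begin

text \<open>Graph G: black vertices B, white vertices W, edges E as pairs (b,w).
  The planar embedding together with the cilia enter only through the edge order at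
  each vertex, given by a list ord v of the neighbours of v (in edge order).
  Colours are 0-indexed: C_v = {0..<n v}.\<close>

definition edge_idx :: "'v list \<Rightarrow> 'v \<Rightarrow> nat" where
  "edge_idx xs u = length (takeWhile (\<lambda>x. x \<noteq> u) xs)"

definition blk_off :: "('v \<Rightarrow> nat) \<Rightarrow> 'v list \<Rightarrow> 'v \<Rightarrow> nat" where
  "blk_off n xs u = sum_list (map n (takeWhile (\<lambda>x. x \<noteq> u) xs))"

definition list_sign :: "nat list \<Rightarrow> real" where
  "list_sign L = of_int (sign (\<lambda>i. if i < length L then L ! i else i))"

definition multiwebs ::
  "'v set \<Rightarrow> 'v set \<Rightarrow> ('v \<times> 'v) set \<Rightarrow> ('v \<Rightarrow> nat) \<Rightarrow> (('v \<times> 'v) \<Rightarrow> nat) set" where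
  "multiwebs B W E n = {m. (\<forall>e. e \<notin> E \<longrightarrow> m e = 0)
     \<and> (\<forall>b\<in>B. (\<Sum>w\<in>{w. (b,w) \<in> E}. m (b,w)) = n b)
     \<and> (\<forall>w\<in>W. (\<Sum>b\<in>{b. (b,w) \<in> E}. m (b,w)) = n w)}"

text \<open>Colorings (S,T) of a multiweb m; S e \<subseteq> C_b, T e \<subseteq> C_w for e = (b,w);
  for m e = 0 the sets are empty (they are not part of the coloring in the paper).\<close>
definition colorings ::
  "'v set \<Rightarrow> 'v set \<Rightarrow> ('v \<times> 'v) set \<Rightarrow> ('v \<Rightarrow> nat) \<Rightarrow> (('v \<times> 'v) \<Rightarrow> nat)
   \<Rightarrow> ((('v \<times> 'v) \<Rightarrow> nat set) \<times> (('v \<times> 'v) \<Rightarrow> nat set)) set" where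
  "colorings B W E n m = {(S,T).
     (\<forall>e. e \<notin> E \<longrightarrow> S e = {} \<and> T e = {})
   \<and> (\<forall>(b,w)\<in>E. S (b,w) \<subseteq> {..<n b} \<and> card (S (b,w)) = m (b,w)
                \<and> T (b,w) \<subseteq> {..<n w} \<and> card (T (b,w)) = m (b,w))
   \<and> (\<forall>b\<in>B. (\<forall>w1 w2. (b,w1) \<in> E \<and> (b,w2) \<in> E \<and> w1 \<noteq> w2 \<longrightarrow> S (b,w1) \<inter> S (b,w2) = {})
             \<and> (\<Union>w\<in>{w. (b,w) \<in> E}. S (b,w)) = {..<n b})
   \<and> (\<forall>w\<in>W. (\<forall>b1 b2. (b1,w) \<in> E \<and> (b2,w) \<in> E \<and> b1 \<noteq> b2 \<longrightarrow> T (b1,w) \<inter> T (b2,w) = {})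
             \<and> (\<Union>b\<in>{b. (b,w) \<in> E}. T (b,w)) = {..<n w})}"

definition trace_Phi ::
  "'v set \<Rightarrow> 'v set \<Rightarrow> ('v \<times> 'v) set \<Rightarrow> ('v \<Rightarrow> nat) \<Rightarrow> ('v \<Rightarrow> 'v list)
   \<Rightarrow> (('v \<times> 'v) \<Rightarrow> real mat) \<Rightarrow> (('v \<times> 'v) \<Rightarrow> nat) \<Rightarrow> real" where
  "trace_Phi B W E n ord \<phi> m = (\<Sum>(S,T) \<in> colorings B W E n m.
      (\<Prod>b\<in>B. list_sign (concat (map (\<lambda>w. sorted_list_of_set (S (b,w))) (ord b))))
    * (\<Prod>w\<in>W. list_sign (concat (map (\<lambda>b. sorted_list_of_set (T (b,w))) (ord w))))
    * (\<Prod>e\<in>{e\<in>E. m e > 0}. det (submatrix (\<phi> e) (T e) (S e))))"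

text \<open>Gadgets: for each vertex v a vertex set gV v, an edge set gE v (2-element sets),
  edge weights gw v, and an ordered list bnd v of boundary vertices.\<close>

definition gadget_sum ::
  "('v \<Rightarrow> 'u set) \<Rightarrow> ('v \<Rightarrow> 'u set set) \<Rightarrow> ('v \<Rightarrow> 'u set \<Rightarrow> real) \<Rightarrow> ('v \<Rightarrow> 'u list)
   \<Rightarrow> 'v \<Rightarrow> nat set \<Rightarrow> real" where
  "gadget_sum gV gE gw bnd v I = (\<Sum>M \<in> {M. M \<subseteq> gE v \<and>
       (\<forall>x\<in>gV v. card {e\<in>M. x \<in> e} =
          (if x \<in> set (bnd v) \<and> x \<notin> (\<lambda>i. bnd v ! i) ` I then 0 else 1))}.
     \<Prod>e\<in>M. gw v e)"

definition hat_V :: "'v set \<Rightarrow> 'v set \<Rightarrow> ('v \<Rightarrow> 'u set) \<Rightarrow> ('v \<times> 'u) set" where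
  "hat_V B W gV = {(v,x). v \<in> B \<union> W \<and> x \<in> gV v}"

definition inner_edges :: "'v set \<Rightarrow> 'v set \<Rightarrow> ('v \<Rightarrow> 'u set set) \<Rightarrow> ('v \<times> 'u) set set" where
  "inner_edges B W gE = {(\<lambda>x. (v,x)) ` e | v e. v \<in> B \<union> W \<and> e \<in> gE v}"

definition mid_edge ::
  "('v \<Rightarrow> nat) \<Rightarrow> ('v \<Rightarrow> 'v list) \<Rightarrow> ('v \<Rightarrow> 'u list) \<Rightarrow> 'v \<Rightarrow> 'v \<Rightarrow> nat \<Rightarrow> ('v \<times> 'u) set" where
  "mid_edge n ord bnd b w i =
     {(b, bnd b ! (blk_off n (ord b) w + i)), (w, bnd w ! (edge_idx (ord w) b * n w + i))}"

definition middle_edges ::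
  "('v \<times> 'v) set \<Rightarrow> ('v \<Rightarrow> nat) \<Rightarrow> ('v \<Rightarrow> 'v list) \<Rightarrow> ('v \<Rightarrow> 'u list) \<Rightarrow> ('v \<times> 'u) set set" where
  "middle_edges E n ord bnd = {mid_edge n ord bnd b w i | b w i. (b,w) \<in> E \<and> i < n w}"

text \<open>Weight in the glued graph: gadget edges keep their weight, middle edges weigh 1.\<close>
definition hat_wt :: "('v \<Rightarrow> 'u set \<Rightarrow> real) \<Rightarrow> ('v \<times> 'u) set \<Rightarrow> real" where
  "hat_wt gw e = (if card (fst ` e) = 1 then gw (the_elem (fst ` e)) (snd ` e) else 1)"

definition dimer_covers :: "'a set \<Rightarrow> 'a set set \<Rightarrow> 'a set set set" where
  "dimer_covers V Ed = {\<pi>. \<pi> \<subseteq> Ed \<and> (\<forall>x\<in>V. card {e\<in>\<pi>. x \<in> e} = 1)}"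

definition m_of_pi ::
  "('v \<times> 'v) set \<Rightarrow> ('v \<Rightarrow> nat) \<Rightarrow> ('v \<Rightarrow> 'v list) \<Rightarrow> ('v \<Rightarrow> 'u list) \<Rightarrow> ('v \<times> 'u) set set
   \<Rightarrow> ('v \<times> 'v) \<Rightarrow> nat" where
  "m_of_pi E n ord bnd \<pi> = (\<lambda>(b,w). if (b,w) \<in> E
      then card {i. i < n w \<and> mid_edge n ord bnd b w i \<notin> \<pi>} else 0)"

end

theory Submission
  imports Defs "HOL-Library.FuncSet" "HOL-Library.Disjoint_Sets"
begin

text \<open>A dimer cover of the glued graph is determined by the set \<open>U e\<close> of unused middle edges over each
  edge \<open>e\<close> together with a matching of every gadget which covers exactly those boundary vertices that
  lie on unused middle edges. Hence the dimer sum is \<open>\<Sum>U. \<Prod>v. \<Delta>\<^sub>U(M\<^sub>v)\<close>. Laplace expansion of the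
  maximal minor \<open>\<Delta>\<^sub>U(M\<^sub>v)\<close> along its blocks produces the colourings at \<open>v\<close> with their signs, and for a
  fixed colouring the sum over \<open>U e\<close> is the Cauchy--Binet expansion of the minor of
  \<open>\<phi>\<^sub>b\<^sub>w = M\<^sub>b\<^sub>w \<phi>'\<^sub>b\<^sub>w\<close> with rows \<open>T e\<close> and columns \<open>S e\<close>.\<close>

section \<open>Minors with listed rows\<close>

text \<open>The difficulty is the bookkeeping of signs. Three conventions meet: maximal minors with
  positions in increasing order, colouring signs that list colour sets in edge order, and minors of
  the connection with sorted rows and columns. Minors are therefore taken with a list of rows and a
  set of columns and expanded recursively along the first row. Blocks of rows are then concatenated
  lists, and every sign is a product of factors \<open>sgn (y - x)\<close>, which also vanishes on
  repetitions. Permutation signs enter only once, through the determinant of a permuted identity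
  matrix. Gluing produces no sign of its own: \<open>U e\<close> is listed in increasing order at
  both ends of \<open>e\<close>, as rows at the black end and as columns at the white end, which is
  the common index set that Cauchy--Binet sums over. The multiweb condition makes the number of
  selected positions at each vertex v equal to \<open>n v\<close>, so that the hypotheses on maximal
  minors apply.\<close>

text \<open>\<open>rsgn c S\<close> is the sign of moving \<open>c\<close> past all smaller elements of \<open>S\<close>, and it is \<open>0\<close> if \<open>c \<in> S\<close>.
  Hence \<open>list_rsgn\<close> is the sign of the permutation sorting a list, and \<open>0\<close> on lists with repetitions.\<close>

definition rsgn :: "nat \<Rightarrow> nat set \<Rightarrow> real" where
  "rsgn c S = (\<Prod>y\<in>S. sgn (real y - real c))"

fun list_rsgn :: "nat list \<Rightarrow> real" where
  "list_rsgn [] = 1"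
| "list_rsgn (x # xs) = rsgn x (set xs) * list_rsgn xs"

text \<open>For disjoint sets this is the sign of the shuffle that lists \<open>S\<close> before
  \<open>T\<close>: one factor -1 for each pair x in \<open>S\<close>, y in \<open>T\<close> with y
  < x.\<close>

definition cross_sgn :: "nat set \<Rightarrow> nat set \<Rightarrow> real" where
  "cross_sgn S T = (\<Prod>x\<in>S. rsgn x T)"

text \<open>The minor of \<open>A\<close> with rows listed in the order of \<open>R\<close> (repetitions allowed) and with the
  columns \<open>S\<close> in increasing order; it vanishes unless \<open>length R = card S\<close>.\<close>

fun lminor :: "(nat \<Rightarrow> nat \<Rightarrow> real) \<Rightarrow> nat list \<Rightarrow> nat set \<Rightarrow> real" where
  "lminor A [] S = (if S = {} then 1 else 0)"
| "lminor A (r # R) S = (\<Sum>c\<in>S. rsgn c (S - {c}) * A r c * lminor A R (S - {c}))"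

lemma rsgn_empty [simp]: "rsgn c {} = 1"
  by (simp add: rsgn_def)

lemma rsgn_insert: "finite S \<Longrightarrow> d \<notin> S \<Longrightarrow> rsgn c (insert d S) = sgn (real d - real c) * rsgn c S"
  by (simp add: rsgn_def)

lemma rsgn_remove: "finite S \<Longrightarrow> d \<in> S \<Longrightarrow> rsgn c S = sgn (real d - real c) * rsgn c (S - {d})"
  unfolding rsgn_def by (rule prod.remove)

lemma rsgn_Un: "finite S \<Longrightarrow> finite T \<Longrightarrow> S \<inter> T = {} \<Longrightarrow> rsgn c (S \<union> T) = rsgn c S * rsgn c T"
  unfolding rsgn_def by (rule prod.union_disjoint)

lemma rsgn_eq_0: "finite S \<Longrightarrow> c \<in> S \<Longrightarrow> rsgn c S = 0"
  by (force simp: rsgn_def)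

lemma rsgn_eq_power: "finite S \<Longrightarrow> c \<notin> S \<Longrightarrow> rsgn c S = (-1) ^ card {y\<in>S. y < c}"
proof (induction S rule: finite_induct)
  case (insert d S)
  then have "{y \<in> insert d S. y < c} = (if d < c then insert d {y\<in>S. y < c} else {y\<in>S. y < c})"
    by auto
  with insert show ?case by (auto simp: rsgn_insert sgn_if)
qed simp

lemma lminor_cong:
  assumes "\<And>r c. r \<in> set R \<Longrightarrow> c \<in> S \<Longrightarrow> A r c = A' r c"
  shows "lminor A R S = lminor A' R S"
  using assms
proof (induction R arbitrary: S)
  case (Cons r R)
  have "lminor A R (S - {c}) = lminor A' R (S - {c})" for c
    using Cons.prems by (intro Cons.IH) auto
  then show ?case using Cons.prems by simp
qed simp

lemma lminor_map: "lminor A (map f R) S = lminor (\<lambda>r. A (f r)) R S"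
  by (induction R arbitrary: S) auto

text \<open>Exchanging the columns c and d chosen for the two rows pairs the terms of the two double
  expansions. Choosing c first contributes \<open>sgn (d - c)\<close>, choosing d first
  \<open>sgn (c - d)\<close>; all other sign factors agree.\<close>

lemma lminor_swap:
  assumes "finite S"
  shows "lminor A (a # b # R) S = - lminor A (b # a # R) S"
proof -
  let ?P = "Sigma S (\<lambda>c. S - {c})"
  define f where "f a b = (\<lambda>(c, d). rsgn c (S - {c}) * A a c *
     (rsgn d (S - {c} - {d}) * A b d * lminor A R (S - {c} - {d})))" for a b
  have eq: "lminor A (a # b # R) S = sum (f a b) ?P" for a b
    using assms by (simp add: f_def sum_distrib_left sum.Sigma)
  have "sum (f a b) ?P = (\<Sum>p\<in>?P. - f b a p)"
  proof (rule sum.reindex_bij_witness[of _ prod.swap prod.swap])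
    fix p assume "p \<in> ?P"
    then obtain c d where p: "p = (c, d)" "c \<in> S" "d \<in> S" "c \<noteq> d" by auto
    have eq: "S - {c} - {d} = S - {d} - {c}" by auto
    have 1: "rsgn c (S - {c}) = sgn (real d - real c) * rsgn c (S - {d} - {c})"
      using p assms by (subst rsgn_remove[of _ d]) (auto simp: eq)
    have 2: "rsgn d (S - {d}) = sgn (real c - real d) * rsgn d (S - {d} - {c})"
      using p assms by (subst rsgn_remove[of _ c]) auto
    have 3: "sgn (real c - real d) = - sgn (real d - real c)" by (auto simp: sgn_if)
    show "- f b a (prod.swap p) = f a b p"
      unfolding p f_def prod.swap_def by (simp add: 1 2 3 eq algebra_simps)
  qed auto
  then show ?thesis by (simp only: eq sum_negf)
qed

text \<open>Row \<open>k\<close> moves to its sorted place by adjacent exchanges, with one change of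
  sign for each smaller entry that it passes.\<close>

lemma lminor_Cons_insort:
  assumes "finite S" "sorted_wrt (<) xs"
  shows "lminor A (k # xs) S = rsgn k (set xs) * lminor A (insort k xs) S"
  using assms
proof (induction xs arbitrary: S)
  case (Cons x xs)
  have IH: "lminor A (x # k # xs) S = rsgn k (set xs) * lminor A (x # insort k xs) S"
  proof -
    have "lminor A (x # k # xs) S
        = (\<Sum>c\<in>S. rsgn c (S - {c}) * A x c * (rsgn k (set xs) * lminor A (insort k xs) (S - {c})))"
      unfolding lminor.simps(2)[of A x] using Cons by (intro sum.cong refl) auto
    then show ?thesis by (simp add: sum_distrib_left algebra_simps)
  qed
  consider "k < x" | "k = x" | "x < k" by linarith
  then show ?case
  proof cases
    case 1
    have "rsgn k (set (x # xs)) = 1"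
      unfolding rsgn_def using 1 Cons.prems by (intro prod.neutral) auto
    then show ?thesis using 1 by simp
  next
    case 2
    \<comment> \<open>A minor with two equal adjacent rows is its own negative, hence 0, and
      \<open>rsgn\<close> vanishes on the right. This is what later discards repeated rows.\<close>
    have "lminor A (k # x # xs) S = - lminor A (k # x # xs) S"
      using lminor_swap[OF Cons.prems(1), of A k x xs] unfolding 2 .
    then have "lminor A (k # x # xs) S = 0" by linarith
    then show ?thesis using 2 by (simp add: rsgn_eq_0)
  next
    case 3
    then have "rsgn k (set (x # xs)) = - rsgn k (set xs)"
      using Cons.prems by (auto simp: rsgn_insert sgn_if)
    then show ?thesis using lminor_swap[OF Cons.prems(1), of A k x xs] IH 3 by simp
  qed
qed simp

section \<open>Cauchy--Binet and Laplace expansion for listed rows\<close>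

text \<open>Both inductions below pick one column and then a set of further columns, while their
  goals sum over the enlarged set.\<close>

lemma sum_choose_elem_swap:
  assumes "finite N"
  shows "(\<Sum>k\<in>N. \<Sum>U\<in>{U. U \<subseteq> N \<and> card U = l \<and> k \<notin> U}. f k U)
       = (\<Sum>U\<in>{U. U \<subseteq> N \<and> card U = Suc l}. \<Sum>k\<in>U. f k (U - {k}))"
proof -
  have fin: "finite {U. U \<subseteq> N \<and> Q U}" for Q using assms by simp
  have finU: "U \<subseteq> N \<Longrightarrow> finite U" for U using assms finite_subset by blast
  have "(\<Sum>k\<in>N. \<Sum>U\<in>{U. U \<subseteq> N \<and> card U = l \<and> k \<notin> U}. f k U)
      = (\<Sum>(k, U)\<in>(SIGMA k:N. {U. U \<subseteq> N \<and> card U = l \<and> k \<notin> U}). f k U)"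
    using assms fin by (intro sum.Sigma) auto
  also have "\<dots> = (\<Sum>(U, k)\<in>(SIGMA U:{U. U \<subseteq> N \<and> card U = Suc l}. U). f k (U - {k}))"
  proof (rule sum.reindex_bij_witness[of _ "\<lambda>(U,k). (k, U - {k})" "\<lambda>(k,U). (insert k U, k)"],
      goal_cases)
    case (2 p)
    then show ?case using finU[of "snd p"] by auto
  next
    case (4 p)
    then show ?case using finU[of "fst p"] by auto
  qed auto
  also have "\<dots> = (\<Sum>U\<in>{U. U \<subseteq> N \<and> card U = Suc l}. \<Sum>k\<in>U. f k (U - {k}))"
    using fin finU by (intro sum.Sigma[symmetric]) auto
  finally show ?thesis .
qed

text \<open>Cauchy--Binet, by expanding the first row of the product. For a fixed intermediate set
  \<open>U\<close> of the other rows, the sum over the columns in \<open>S\<close> reassembles the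
  minor of \<open>Q\<close> with row k put in front of the rows \<open>U\<close>. Sorting k into
  place kills the terms with k in \<open>U\<close> and otherwise costs \<open>rsgn k U\<close>,
  which is exactly the sign of column k in the expansion of the minor of \<open>P\<close> with
  columns \<open>insert k U\<close>.\<close>

lemma lminor_mult:
  assumes "finite N" "finite S"
  shows "lminor (\<lambda>i j. \<Sum>k\<in>N. P i k * Q k j) R S
       = (\<Sum>U\<in>{U. U \<subseteq> N \<and> card U = length R}. lminor P R U * lminor Q (sorted_list_of_set U) S)"
  using assms(2)
proof (induction R arbitrary: S)
  case Nil
  have "{U. U \<subseteq> N \<and> card U = 0} = {{}}"
    using assms(1) by (auto dest: finite_subset)
  then show ?case by simp
next
  case (Cons r R)
  let ?PQ = "\<lambda>i j. \<Sum>k\<in>N. P i k * Q k j" and ?C = "\<lambda>l. {U. U \<subseteq> N \<and> card U = l}"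
  let ?s = sorted_list_of_set
  have finU: "U \<subseteq> N \<Longrightarrow> finite U" for U using assms(1) finite_subset by blast
  have finC: "finite (?C l)" for l using assms(1) by simp
  have ins: "lminor Q (k # ?s U) S = rsgn k U * lminor Q (insort k (?s U)) S" if "U \<subseteq> N" for k U
    using lminor_Cons_insort[OF Cons.prems, of "?s U" Q k] finU[OF that] by simp
  have "lminor ?PQ (r # R) S
      = (\<Sum>c\<in>S. \<Sum>U\<in>?C (length R). \<Sum>k\<in>N. P r k * lminor P R U
           * (rsgn c (S - {c}) * Q k c * lminor Q (?s U) (S - {c})))"
    unfolding lminor.simps(2)[of ?PQ] using Cons.prems
    by (intro sum.cong refl) (simp add: Cons.IH sum_distrib_left sum_distrib_right mult.assoc mult.left_commute)
  also have "\<dots> = (\<Sum>U\<in>?C (length R). \<Sum>c\<in>S. \<Sum>k\<in>N. P r k * lminor P R U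
           * (rsgn c (S - {c}) * Q k c * lminor Q (?s U) (S - {c})))"
    by (rule sum.swap)
  also have "\<dots> = (\<Sum>U\<in>?C (length R). \<Sum>k\<in>N. \<Sum>c\<in>S. P r k * lminor P R U
           * (rsgn c (S - {c}) * Q k c * lminor Q (?s U) (S - {c})))"
    by (intro sum.cong refl sum.swap)
  also have "\<dots> = (\<Sum>k\<in>N. \<Sum>U\<in>?C (length R). \<Sum>c\<in>S. P r k * lminor P R U
           * (rsgn c (S - {c}) * Q k c * lminor Q (?s U) (S - {c})))"
    by (rule sum.swap)
  also have "\<dots> = (\<Sum>k\<in>N. \<Sum>U\<in>?C (length R). P r k * lminor P R U * lminor Q (k # ?s U) S)"
    by (simp add: sum_distrib_left)
  also have "\<dots> = (\<Sum>k\<in>N. \<Sum>U\<in>{U. U \<subseteq> N \<and> card U = length R \<and> k \<notin> U}.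
      P r k * lminor P R U * (rsgn k U * lminor Q (insort k (?s U)) S))"
    using finU by (intro sum.cong[OF refl] sum.mono_neutral_cong_right finC)
      (auto simp: ins rsgn_eq_0 simp del: lminor.simps)
  also have "\<dots> = (\<Sum>U\<in>?C (length (r # R)). \<Sum>k\<in>U.
      P r k * lminor P R (U - {k}) * (rsgn k (U - {k}) * lminor Q (insort k (?s (U - {k}))) S))"
    by (subst sum_choose_elem_swap[OF assms(1)]) simp
  also have "\<dots> = (\<Sum>U\<in>?C (length (r # R)). \<Sum>k\<in>U.
      rsgn k (U - {k}) * P r k * lminor P R (U - {k}) * lminor Q (?s U) S)"
  proof (intro sum.cong refl)
    fix U k assume U: "U \<in> ?C (length (r # R))" and k: "k \<in> U"
    have "insort k (?s (U - {k})) = ?s U"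
      using U k finU[of U] sorted_list_of_set_insert_remove[of U k] by (simp add: insert_absorb)
    then show "P r k * lminor P R (U - {k}) * (rsgn k (U - {k}) * lminor Q (insort k (?s (U - {k}))) S)
       = rsgn k (U - {k}) * P r k * lminor P R (U - {k}) * lminor Q (?s U) S"
      by simp
  qed
  finally show ?case by (simp add: sum_distrib_right)
qed

text \<open>Laplace expansion along a block of rows. The sign of a column of the first block against
  all other columns factors into its sign against the rest of that block, absorbed by the minor of
  \<open>R1\<close>, and its sign against \<open>S - S1\<close>, collected in
  \<open>cross_sgn\<close>.\<close>

lemma lminor_append:
  assumes "finite S"
  shows "lminor A (R1 @ R2) S = (\<Sum>S1\<in>{S1. S1 \<subseteq> S \<and> card S1 = length R1}.
     cross_sgn S1 (S - S1) * lminor A R1 S1 * lminor A R2 (S - S1))"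
  using assms
proof (induction R1 arbitrary: S)
  case Nil
  have "{U. U \<subseteq> S \<and> card U = 0} = {{}}"
    using Nil by (auto dest: finite_subset)
  then show ?case by (simp add: cross_sgn_def)
next
  case (Cons r R1)
  have finU: "U \<subseteq> S \<Longrightarrow> finite U" for U using Cons.prems finite_subset by blast
  have "lminor A ((r # R1) @ R2) S = (\<Sum>c\<in>S. \<Sum>U\<in>{U. U \<subseteq> S - {c} \<and> card U = length R1}.
     rsgn c (S - {c}) * A r c * (cross_sgn U (S - {c} - U) * lminor A R1 U * lminor A R2 (S - {c} - U)))"
    using Cons by (simp add: sum_distrib_left)
  also have "\<dots> = (\<Sum>c\<in>S. \<Sum>U\<in>{U. U \<subseteq> S \<and> card U = length R1 \<and> c \<notin> U}.
     rsgn c (S - {c}) * A r c * (cross_sgn U (S - {c} - U) * lminor A R1 U * lminor A R2 (S - {c} - U)))"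
    by (intro sum.cong refl) auto
  also have "\<dots> = (\<Sum>U\<in>{U. U \<subseteq> S \<and> card U = Suc (length R1)}. \<Sum>c\<in>U.
     rsgn c (S - {c}) * A r c * (cross_sgn (U - {c}) (S - {c} - (U - {c})) * lminor A R1 (U - {c})
       * lminor A R2 (S - {c} - (U - {c}))))"
    by (rule sum_choose_elem_swap[OF Cons.prems])
  also have "\<dots> = (\<Sum>U\<in>{U. U \<subseteq> S \<and> card U = Suc (length R1)}. \<Sum>c\<in>U.
     cross_sgn U (S - U) * (rsgn c (U - {c}) * A r c * lminor A R1 (U - {c})) * lminor A R2 (S - U))"
  proof (intro sum.cong refl)
    fix U c assume "U \<in> {U. U \<subseteq> S \<and> card U = Suc (length R1)}" and c: "c \<in> U"
    then have U: "U \<subseteq> S" "finite U" using finU by auto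
    have eq: "S - {c} - (U - {c}) = S - U" using c by auto
    have "S - {c} = (U - {c}) \<union> (S - U)" using U c by auto
    then have "rsgn c (S - {c}) = rsgn c (U - {c}) * rsgn c (S - U)"
      using U Cons.prems by (simp only:) (rule rsgn_Un, auto)
    moreover have "cross_sgn U (S - U) = rsgn c (S - U) * cross_sgn (U - {c}) (S - U)"
      unfolding cross_sgn_def by (rule prod.remove[OF U(2) c])
    ultimately show "rsgn c (S - {c}) * A r c * (cross_sgn (U - {c}) (S - {c} - (U - {c})) * lminor A R1 (U - {c})
       * lminor A R2 (S - {c} - (U - {c}))) =
       cross_sgn U (S - U) * (rsgn c (U - {c}) * A r c * lminor A R1 (U - {c})) * lminor A R2 (S - U)"
      unfolding eq by simp
  qed
  finally show ?case by (simp add: sum_distrib_left sum_distrib_right)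
qed

lemma list_rsgn_append:
  assumes "distinct (xs @ ys)"
  shows "list_rsgn (xs @ ys) = cross_sgn (set xs) (set ys) * list_rsgn xs * list_rsgn ys"
  using assms by (induction xs) (auto simp: cross_sgn_def rsgn_Un)

lemma list_rsgn_strict_sorted: "sorted_wrt (<) xs \<Longrightarrow> list_rsgn xs = 1"
  by (induction xs) (auto simp: rsgn_def intro!: prod.neutral)

section \<open>Comparison with determinants and permutation signs\<close>

lemma card_less_nth_sorted:
  assumes "finite S" "j < card S"
  shows "card {y\<in>S. y < sorted_list_of_set S ! j} = j"
proof -
  let ?s = "sorted_list_of_set S"
  have len: "length ?s = card S" by simp
  have mono: "?s ! a < ?s ! b \<longleftrightarrow> a < b" if "a < card S" "b < card S" for a b
    using that sorted_wrt_nth_less[OF strict_sorted_list_of_set[of S]] len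
    by (metis linorder_neqE_nat not_less_iff_gr_or_eq)
  have "{y\<in>S. y < ?s ! j} = (!) ?s ` {..<j}"
  proof (intro equalityI subsetI)
    fix y assume "y \<in> {y\<in>S. y < ?s ! j}"
    then obtain i where "i < card S" "y = ?s ! i" "?s ! i < ?s ! j"
      using set_sorted_list_of_set[OF assms(1)] len by (metis (no_types, lifting) in_set_conv_nth mem_Collect_eq)
    then show "y \<in> (!) ?s ` {..<j}" using mono assms by auto
  next
    fix y assume "y \<in> (!) ?s ` {..<j}"
    then obtain i where i: "i < j" "y = ?s ! i" by auto
    then have "y \<in> set ?s" using assms len nth_mem[of i ?s] by simp
    then show "y \<in> {y\<in>S. y < ?s ! j}" using i mono assms by auto
  qed
  moreover have "inj_on ((!) ?s) {..<j}"
    using assms by (intro inj_on_nth) auto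
  ultimately show ?thesis by (simp add: card_image)
qed

text \<open>\<open>submatrix\<close> addresses its rows and columns through \<open>pick\<close>;
  this translates to sorted lists.\<close>

lemma pick_eq_nth_sorted:
  assumes "finite S" "j < card S"
  shows "pick S j = sorted_list_of_set S ! j"
proof -
  have "sorted_list_of_set S ! j \<in> S"
    using assms nth_mem[of j "sorted_list_of_set S"] by simp
  from pick_card_in_set[OF this] show ?thesis
    using card_less_nth_sorted[OF assms] by simp
qed

lemma nth_sorted_list_of_set_remove:
  assumes "finite S" "j < card S" "i < card S - 1"
  shows "sorted_list_of_set (S - {sorted_list_of_set S ! j}) ! i
       = sorted_list_of_set S ! (if i < j then i else Suc i)"
proof -
  let ?s = "sorted_list_of_set S"
  have "?s = take j ?s @ ?s ! j # drop (Suc j) ?s"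
    using assms by (intro id_take_nth_drop) simp
  moreover have "?s ! j \<notin> set (take j ?s)"
    using assms by (auto simp: in_set_conv_nth nth_eq_iff_index_eq)
  ultimately have "remove1 (?s ! j) ?s = take j ?s @ drop (Suc j) ?s"
    by (metis remove1.simps(2) remove1_append)
  then show ?thesis
    using assms by (auto simp: sorted_list_of_set_remove nth_append)
qed

text \<open>The recursion is the cofactor expansion along row 0: exactly j elements of
  \<open>S\<close> precede the one at index j, so \<open>rsgn\<close> is the cofactor sign.\<close>

lemma lminor_eq_det:
  assumes "finite S" "length R = card S"
  shows "lminor A R S = det (mat (length R) (length R) (\<lambda>(i,j). A (R ! i) (sorted_list_of_set S ! j)))"
  using assms
proof (induction R arbitrary: S)
  case (Cons r R)
  let ?s = "sorted_list_of_set S" and ?n = "Suc (length R)"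
  let ?M = "mat ?n ?n (\<lambda>(i,j). A ((r # R) ! i) (?s ! j))"
  have n: "card S = ?n" using Cons.prems by simp
  have "lminor A (r # R) S = (\<Sum>j<?n. rsgn (?s ! j) (S - {?s ! j}) * A r (?s ! j) * lminor A R (S - {?s ! j}))"
    unfolding lminor.simps
    by (rule sum.reindex_bij_betw[symmetric], rule bij_betw_nth) (use Cons.prems n in auto)
  also have "\<dots> = (\<Sum>j<?n. ?M $$ (0, j) * cofactor ?M 0 j)"
  proof (rule sum.cong[OF refl])
    fix j assume "j \<in> {..<?n}"
    then have j: "j < ?n" by simp
    have mem: "?s ! j \<in> S"
      using Cons.prems j n nth_mem[of j ?s] by simp
    have "{y\<in>S - {?s ! j}. y < ?s ! j} = {y\<in>S. y < ?s ! j}" by auto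
    then have 1: "rsgn (?s ! j) (S - {?s ! j}) = (-1) ^ j"
      using Cons.prems j n by (simp add: rsgn_eq_power card_less_nth_sorted)
    have 2: "mat_delete ?M 0 j
       = mat (length R) (length R) (\<lambda>(i,k). A (R ! i) (sorted_list_of_set (S - {?s ! j}) ! k))"
      by (rule eq_matI)
        (use Cons.prems j n in \<open>auto simp: mat_delete_def nth_sorted_list_of_set_remove\<close>)
    have "lminor A R (S - {?s ! j}) = det (mat_delete ?M 0 j)"
      unfolding 2 using Cons.prems mem by (intro Cons.IH) auto
    then show "rsgn (?s ! j) (S - {?s ! j}) * A r (?s ! j) * lminor A R (S - {?s ! j})
       = ?M $$ (0, j) * cofactor ?M 0 j"
      using j 1 by (simp add: cofactor_def)
  qed
  also have "\<dots> = det ?M"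
    by (rule laplace_expansion_row[symmetric]) auto
  finally show ?case by simp
qed simp

lemma det_submatrix_eq_lminor:
  assumes "A \<in> carrier_mat nr nc" "I \<subseteq> {..<nr}" "J \<subseteq> {..<nc}" "card I = card J"
  shows "det (submatrix A I J) = lminor (\<lambda>i j. A $$ (i, j)) (sorted_list_of_set I) J"
proof -
  have fin: "finite I" "finite J" using assms finite_subset by blast+
  have "{i. i < nr \<and> i \<in> I} = I" "{j. j < nc \<and> j \<in> J} = J" using assms by auto
  then have "submatrix A I J = mat (card I) (card I)
      (\<lambda>(i,j). A $$ (sorted_list_of_set I ! i, sorted_list_of_set J ! j))"
    unfolding submatrix_def using assms fin
    by (intro eq_matI) (auto simp: pick_eq_nth_sorted)
  then show ?thesis using assms fin by (subst lminor_eq_det) auto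
qed

text \<open>\<open>lminor\<close> treats rows and columns asymmetrically, and at a white vertex it
  is the columns that come in blocks. The symmetry is imported from
  \<open>det_transpose\<close>.\<close>

lemma lminor_transpose:
  assumes "finite I" "finite J" "card I = card J"
  shows "lminor A (sorted_list_of_set I) J = lminor (\<lambda>i j. A j i) (sorted_list_of_set J) I"
proof -
  let ?M = "mat (card I) (card I) (\<lambda>(i,j). A (sorted_list_of_set I ! i) (sorted_list_of_set J ! j))"
  have "det (transpose_mat ?M) = det ?M" by (rule det_transpose) auto
  moreover have "transpose_mat ?M = mat (card I) (card I)
      (\<lambda>(i,j). A (sorted_list_of_set I ! j) (sorted_list_of_set J ! i))"
    by (rule eq_matI) auto
  ultimately show ?thesis using assms by (simp add: lminor_eq_det)
qed

text \<open>In a minor of the identity matrix only the column equal to the listed row survives, and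
  it carries the factor from \<open>list_rsgn\<close>.\<close>

lemma lminor_of_bool_eq_list_rsgn:
  "distinct L \<Longrightarrow> lminor (\<lambda>r c. of_bool (c = r)) L (set L) = list_rsgn L"
proof (induction L)
  case (Cons x xs)
  let ?f = "\<lambda>c. rsgn c (insert x (set xs) - {c}) * of_bool (c = x)
      * lminor (\<lambda>r c. of_bool (c = r)) xs (insert x (set xs) - {c})"
  have "lminor (\<lambda>r c. of_bool (c = r)) (x # xs) (set (x # xs)) = sum ?f {x}"
    unfolding lminor.simps list.set by (rule sum.mono_neutral_right) auto
  then show ?case using Cons by simp
qed simp

text \<open>Both sides are the determinant of the identity matrix with rows permuted by
  \<open>L\<close>: \<open>lminor\<close> evaluates it by signs of pairs,
  \<open>det_permute_rows\<close> by the permutation sign.\<close>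

lemma list_sign_eq_list_rsgn:
  assumes "distinct L" "set L = {..<length L}"
  shows "list_sign L = list_rsgn L"
proof -
  define n where "n = length L"
  define p where "p i = (if i < n then L ! i else i)" for i
  have set: "set L = {0..<n}" using assms(2) by (simp only: n_def atLeast0LessThan)
  have "bij_betw ((!) L) {0..<n} {0..<n}"
    by (rule bij_betw_nth) (use assms(1) set in \<open>simp_all add: n_def atLeast0LessThan\<close>)
  then have "bij_betw p {0..<n} {0..<n}"
    by (rule bij_betw_cong[THEN iffD1, rotated]) (simp add: p_def)
  then have p: "p permutes {0..<n}"
    by (rule bij_imp_permutes) (auto simp: p_def)
  have "list_rsgn L = lminor (\<lambda>r c. of_bool (c = r)) L {0..<n}"
    using lminor_of_bool_eq_list_rsgn[OF assms(1)] set by simp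
  also have "\<dots> = det (mat n n (\<lambda>(i,j). of_bool (sorted_list_of_set {0..<n} ! j = L ! i)))"
    by (subst lminor_eq_det) (auto simp: n_def)
  also have "mat n n (\<lambda>(i,j). of_bool (sorted_list_of_set {0..<n} ! j = L ! i))
      = mat n n (\<lambda>(i,j). (1\<^sub>m n :: real mat) $$ (p i, j))"
  proof (rule eq_matI, goal_cases)
    case (1 i j)
    then have "L ! i < n" using set nth_mem[of i L] by (auto simp: n_def)
    then show ?case using 1 by (auto simp: p_def)
  qed auto
  also have "det \<dots> = signof p"
    using det_permute_rows[OF one_carrier_mat p, where 'a = real] by simp
  also have "\<dots> = list_sign L"
    by (simp add: list_sign_def p_def[abs_def] n_def)
  finally show ?thesis by simp
qed

section \<open>Labelled set partitions and Laplace expansion along several blocks\<close>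

text \<open>Parts may be empty, since an edge with \<open>m e = 0\<close> receives the empty colour
  set. Extensionality makes a sum count each partition once.\<close>

definition set_parts :: "'a set \<Rightarrow> ('a \<Rightarrow> nat) \<Rightarrow> nat set \<Rightarrow> ('a \<Rightarrow> nat set) set" where
  "set_parts X k S = {s \<in> X \<rightarrow>\<^sub>E Pow S. (\<forall>x\<in>X. card (s x) = k x) \<and> disjoint_family_on s X
     \<and> (\<Union>x\<in>X. s x) = S}"

lemma mem_set_parts_iff:
  "s \<in> set_parts X k S \<longleftrightarrow> s \<in> extensional X \<and> (\<forall>x\<in>X. s x \<subseteq> S \<and> card (s x) = k x)
     \<and> (\<forall>x\<in>X. \<forall>y\<in>X. x \<noteq> y \<longrightarrow> s x \<inter> s y = {}) \<and> (\<Union>x\<in>X. s x) = S"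
  by (auto simp: set_parts_def disjoint_family_on_def PiE_def)

lemma finite_set_parts: "finite X \<Longrightarrow> finite S \<Longrightarrow> finite (set_parts X k S)"
  unfolding set_parts_def by (rule finite_subset[of _ "X \<rightarrow>\<^sub>E Pow S"]) (auto intro: finite_PiE)

lemma distinct_concat_parts:
  assumes "distinct xs" "disjoint_family_on s (set xs)" "\<And>x. x \<in> set xs \<Longrightarrow> finite (s x)"
  shows "distinct (concat (map (\<lambda>x. sorted_list_of_set (s x)) xs))"
    and "set (concat (map (\<lambda>x. sorted_list_of_set (s x)) xs)) = (\<Union>x\<in>set xs. s x)"
  using assms by (induction xs) (auto simp: disjoint_family_on_def)

text \<open>Choosing the part of \<open>x\<close> first mirrors splitting off the first block of
  rows in \<open>lminor_append\<close>.\<close>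

lemma sum_set_parts_insert:
  assumes "finite S" "x \<notin> X" "finite X"
  shows "(\<Sum>s\<in>set_parts (insert x X) k S. f s)
       = (\<Sum>S1\<in>{S1. S1 \<subseteq> S \<and> card S1 = k x}. \<Sum>s\<in>set_parts X k (S - S1). f (s(x := S1)))"
proof -
  have "(\<Sum>S1\<in>{S1. S1 \<subseteq> S \<and> card S1 = k x}. \<Sum>s\<in>set_parts X k (S - S1). f (s(x := S1)))
     = (\<Sum>(S1,s)\<in>(SIGMA S1:{S1. S1 \<subseteq> S \<and> card S1 = k x}. set_parts X k (S - S1)). f (s(x := S1)))"
    using assms by (intro sum.Sigma) (auto intro: finite_set_parts)
  also have "\<dots> = (\<Sum>s\<in>set_parts (insert x X) k S. f s)"
  proof (rule sum.reindex_bij_witness[of _ "\<lambda>s. (s x, restrict s X)" "\<lambda>(S1,s). s(x := S1)"], goal_cases)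
    case (1 p)
    then show ?case using assms(2)
      by (auto simp: set_parts_def PiE_def extensional_def restrict_def fun_eq_iff)
  next
    case (2 p)
    then obtain S1 s where p: "p = (S1, s)" "S1 \<subseteq> S" "card S1 = k x" "s \<in> set_parts X k (S - S1)"
      by auto
    have "(\<Union>y\<in>X. (s(x := S1)) y) = (\<Union>y\<in>X. s y)"
      by (rule SUP_cong) (use assms(2) in auto)
    then have "(\<Union>y\<in>insert x X. (s(x := S1)) y) = S1 \<union> (\<Union>y\<in>X. s y)"
      by (simp only: UN_insert fun_upd_same)
    also have "\<dots> = S" using p by (auto simp: set_parts_def)
    finally have U: "(\<Union>y\<in>insert x X. (s(x := S1)) y) = S" .
    have s: "s \<in> extensional X" "\<forall>y\<in>X. s y \<subseteq> S - S1 \<and> card (s y) = k y"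
      "\<And>y z. y \<in> X \<Longrightarrow> z \<in> X \<Longrightarrow> y \<noteq> z \<Longrightarrow> s y \<inter> s z = {}"
      using p(4) by (auto simp: mem_set_parts_iff)
    have "(s(x := S1)) y \<inter> (s(x := S1)) z = {}" if yz: "y \<in> insert x X" "z \<in> insert x X" "y \<noteq> z" for y z
    proof -
      consider "y \<in> X" "z \<in> X" "y \<noteq> x" "z \<noteq> x" | "y = x" "z \<in> X" "z \<noteq> x" | "z = x" "y \<in> X" "y \<noteq> x"
        using yz assms(2) by blast
      then show ?thesis by cases (use s yz(3) in auto)
    qed
    moreover have "\<forall>y\<in>insert x X. (s(x := S1)) y \<subseteq> S \<and> card ((s(x := S1)) y) = k y"
      using s(2) p(2,3) by auto
    moreover have "s(x := S1) \<in> extensional (insert x X)"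
      using s(1) by (auto simp: extensional_def)
    ultimately have "s(x := S1) \<in> set_parts (insert x X) k S"
      unfolding mem_set_parts_iff using U by blast
    then show ?case using p(1) by simp
  next
    case (3 s)
    then have "s \<in> extensional (insert x X)" by (auto simp: set_parts_def PiE_def)
    then show ?case using assms(2) by (auto simp: fun_eq_iff extensional_def restrict_def)
  next
    case (4 s)
    then have s: "\<forall>y\<in>insert x X. s y \<subseteq> S \<and> card (s y) = k y" "(\<Union>y\<in>insert x X. s y) = S"
       "\<And>y z. y \<in> insert x X \<Longrightarrow> z \<in> insert x X \<Longrightarrow> y \<noteq> z \<Longrightarrow> s y \<inter> s z = {}"
      unfolding mem_set_parts_iff by blast+
    have disj: "s x \<inter> s y = {}" if "y \<in> X" for y
      using s(3)[of x y] that assms(2) by blast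
    have "(\<Union>y\<in>X. s y) = S - s x" using s(2) disj by blast
    moreover have "\<forall>y\<in>X. s y \<subseteq> S - s x \<and> card (s y) = k y" using s(1) disj by blast
    ultimately have "restrict s X \<in> set_parts X k (S - s x)"
      unfolding mem_set_parts_iff using s(3) by simp
    then show ?case using s(1) by simp
  next
    case (5 p) then show ?case by auto
  qed
  finally show ?thesis by simp
qed

text \<open>Iterated Laplace expansion. The \<open>cross_sgn\<close> of a split times the sign of
  the remaining blocks is the sign of the whole concatenation, because a sorted block alone has sign
  1. The colouring signs originate here.\<close>

lemma lminor_concat:
  assumes "distinct xs" "finite S"
  shows "lminor A (concat (map R xs)) S = (\<Sum>s\<in>set_parts (set xs) (\<lambda>x. length (R x)) S.
     list_rsgn (concat (map (\<lambda>x. sorted_list_of_set (s x)) xs)) * (\<Prod>x\<in>set xs. lminor A (R x) (s x)))"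
  using assms
proof (induction xs arbitrary: S)
  case Nil
  have "set_parts {} k S = (if S = {} then {\<lambda>_. undefined} else {})" for k :: "'a \<Rightarrow> nat"
    by (auto simp: set_parts_def disjoint_family_on_def)
  then show ?case by simp
next
  case (Cons x xs)
  let ?k = "\<lambda>x. length (R x)" and ?s = sorted_list_of_set
  have "lminor A (concat (map R (x # xs))) S = (\<Sum>S1\<in>{S1. S1 \<subseteq> S \<and> card S1 = ?k x}.
      \<Sum>s\<in>set_parts (set xs) ?k (S - S1). cross_sgn S1 (S - S1) * lminor A (R x) S1 *
        (list_rsgn (concat (map (\<lambda>x. ?s (s x)) xs)) * (\<Prod>x\<in>set xs. lminor A (R x) (s x))))"
    using Cons by (simp add: lminor_append sum_distrib_left)
  also have "\<dots> = (\<Sum>S1\<in>{S1. S1 \<subseteq> S \<and> card S1 = ?k x}.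
      \<Sum>s\<in>set_parts (set xs) ?k (S - S1).
        list_rsgn (concat (map (\<lambda>y. ?s ((s(x := S1)) y)) (x # xs))) *
          (\<Prod>y\<in>set (x # xs). lminor A (R y) ((s(x := S1)) y)))"
  proof (intro sum.cong refl)
    fix S1 s assume S1: "S1 \<in> {S1. S1 \<subseteq> S \<and> card S1 = ?k x}" and s: "s \<in> set_parts (set xs) ?k (S - S1)"
    have fin: "finite S1" "finite (S - S1)" using S1 Cons.prems finite_subset by auto
    have map_eq: "map (\<lambda>y. ?s ((s(x := S1)) y)) xs = map (\<lambda>y. ?s (s y)) xs"
      using Cons.prems by auto
    have prod_eq: "(\<Prod>y\<in>set xs. lminor A (R y) ((s(x := S1)) y)) = (\<Prod>x\<in>set xs. lminor A (R x) (s x))"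
      using Cons.prems by (intro prod.cong) auto
    have "distinct (concat (map (\<lambda>y. ?s (s y)) xs))" "set (concat (map (\<lambda>y. ?s (s y)) xs)) = S - S1"
      using distinct_concat_parts[of xs s] Cons.prems s fin finite_subset[OF _ fin(2)]
      by (auto simp: set_parts_def PiE_def Pi_def)
    then have "list_rsgn (?s S1 @ concat (map (\<lambda>y. ?s (s y)) xs))
       = cross_sgn S1 (S - S1) * list_rsgn (concat (map (\<lambda>y. ?s (s y)) xs))"
      using fin by (subst list_rsgn_append) (auto simp: list_rsgn_strict_sorted)
    then show "cross_sgn S1 (S - S1) * lminor A (R x) S1 *
        (list_rsgn (concat (map (\<lambda>x. ?s (s x)) xs)) * (\<Prod>x\<in>set xs. lminor A (R x) (s x)))
      = list_rsgn (concat (map (\<lambda>y. ?s ((s(x := S1)) y)) (x # xs))) *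
          (\<Prod>y\<in>set (x # xs). lminor A (R y) ((s(x := S1)) y))"
      unfolding list.map concat.simps map_eq using Cons.prems prod_eq by simp
  qed
  also have "\<dots> = (\<Sum>s\<in>set_parts (set (x # xs)) ?k S.
     list_rsgn (concat (map (\<lambda>x. ?s (s x)) (x # xs))) * (\<Prod>x\<in>set (x # xs). lminor A (R x) (s x)))"
    using Cons.prems by (simp only: list.set) (rule sum_set_parts_insert[symmetric], auto)
  finally show ?case .
qed

section \<open>Positions in consecutive blocks\<close>

lemma blk_off_Cons: "blk_off k (x # xs) u = (if u = x then 0 else k x + blk_off k xs u)"
  by (auto simp: blk_off_def)

text \<open>All blocks at a white vertex have the same size, so their offsets are block offsets for
  a constant size function, and both colours share the lemmas on blocks.\<close>

lemma blk_off_const: "blk_off (\<lambda>_. c) xs u = edge_idx xs u * c"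
  by (simp add: blk_off_def edge_idx_def sum_list_triv)

lemma bij_betw_blk_off:
  assumes "distinct xs"
  shows "bij_betw (\<lambda>(u,i). blk_off k xs u + i) (SIGMA u:set xs. {..<k u}) {..<sum_list (map k xs)}"
  using assms
proof (induction xs)
  case (Cons x xs)
  let ?f = "\<lambda>(u,i). blk_off k (x # xs) u + i"
  have "bij_betw ?f ({x} \<times> {..<k x}) {..<k x}"
    by (rule bij_betwI[of _ _ _ "\<lambda>i. (x, i)"]) (auto simp: blk_off_Cons)
  moreover have "bij_betw (\<lambda>j. k x + j) {..<sum_list (map k xs)} {k x..<k x + sum_list (map k xs)}"
    by (rule bij_betwI[of _ _ _ "\<lambda>j. j - k x"]) auto
  then have "bij_betw ((\<lambda>j. k x + j) \<circ> (\<lambda>(u,i). blk_off k xs u + i)) (SIGMA u:set xs. {..<k u})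
      {k x..<k x + sum_list (map k xs)}"
    using Cons by (intro bij_betw_trans) auto
  then have "bij_betw ?f (SIGMA u:set xs. {..<k u}) {k x..<k x + sum_list (map k xs)}"
    by (rule bij_betw_cong[THEN iffD1, rotated]) (use Cons.prems in \<open>auto simp: blk_off_Cons\<close>)
  ultimately have "bij_betw ?f ({x} \<times> {..<k x} \<union> (SIGMA u:set xs. {..<k u}))
     ({..<k x} \<union> {k x..<k x + sum_list (map k xs)})"
    by (rule bij_betw_combine) auto
  moreover have "{x} \<times> {..<k x} \<union> (SIGMA u:set xs. {..<k u}) = (SIGMA u:set (x # xs). {..<k u})"
    by auto
  moreover have "{..<k x} \<union> {k x..<k x + sum_list (map k xs)} = {..<sum_list (map k (x # xs))}"
    by auto
  ultimately show ?case by simp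
qed (simp add: bij_betw_def)

text \<open>Consecutive blocks do not interleave, so sorting happens within each block. This brings
  the rows of a maximal minor into the form that \<open>lminor_concat\<close> expands.\<close>

lemma sorted_list_of_set_blocks:
  assumes "distinct xs" "\<And>u. u \<in> set xs \<Longrightarrow> U u \<subseteq> {..<k u}"
  shows "sorted_list_of_set (\<Union>u\<in>set xs. (+) (blk_off k xs u) ` U u)
       = concat (map (\<lambda>u. map ((+) (blk_off k xs u)) (sorted_list_of_set (U u))) xs)"
proof -
  let ?L = "\<lambda>xs. concat (map (\<lambda>u. map ((+) (blk_off k xs u)) (sorted_list_of_set (U u))) xs)"
  have fin: "finite (U u)" if "u \<in> set xs" for u
    using assms(2)[OF that] finite_subset by blast
  have "sorted_wrt (<) (?L xs)" using assms
  proof (induction xs)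
    case (Cons x xs)
    have "map (\<lambda>u. map ((+) (blk_off k (x # xs) u)) (sorted_list_of_set (U u))) xs
       = map (map ((+) (k x)) \<circ> (\<lambda>u. map ((+) (blk_off k xs u)) (sorted_list_of_set (U u)))) xs"
      using Cons.prems(1) by (auto simp: blk_off_Cons add.assoc)
    moreover have "map ((+) (blk_off k (x # xs) x)) ys = ys" for ys
      by (induction ys) (simp_all add: blk_off_Cons)
    ultimately have eq: "?L (x # xs) = sorted_list_of_set (U x) @ map ((+) (k x)) (?L xs)"
      by (simp only: list.map concat.simps map_concat map_map)
    have "sorted_wrt (<) (map ((+) (k x)) (?L xs))"
      using Cons by (simp add: sorted_wrt_map)
    moreover have "finite (U x)" "\<forall>y\<in>U x. y < k x"
      using Cons.prems(2)[of x] finite_subset by auto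
    ultimately show ?case unfolding eq sorted_wrt_append
      by (auto simp del: set_concat)
  qed simp
  moreover have "set (?L xs) = (\<Union>u\<in>set xs. (+) (blk_off k xs u) ` U u)"
    using fin by auto
  ultimately show ?thesis
    using fin by (intro strict_sorted_equal) auto
qed

section \<open>Dimer covers of glued gadgets\<close>

text \<open>\<open>p v e i\<close> is the position in \<open>bnd v\<close> of the end at \<open>v\<close> of the \<open>i\<close>-th middle edge over \<open>e\<close>.\<close>

locale glued_gadgets =
  fixes B W :: "'v set" and E :: "'e set" and src tgt :: "'e \<Rightarrow> 'v" and n :: "'v \<Rightarrow> nat"
    and p :: "'v \<Rightarrow> 'e \<Rightarrow> nat \<Rightarrow> nat"
    and gV :: "'v \<Rightarrow> 'u set" and gE :: "'v \<Rightarrow> 'u set set" and gw :: "'v \<Rightarrow> 'u set \<Rightarrow> real"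
    and bnd :: "'v \<Rightarrow> 'u list"
  assumes fin: "finite B" "finite W" "finite E"
    and BW: "B \<inter> W = {}" and src: "e \<in> E \<Longrightarrow> src e \<in> B" and tgt: "e \<in> E \<Longrightarrow> tgt e \<in> W"
    and finite_gV: "v \<in> B \<union> W \<Longrightarrow> finite (gV v)"
    and gE_subset: "v \<in> B \<union> W \<Longrightarrow> f \<in> gE v \<Longrightarrow> f \<subseteq> gV v"
    and gE_nonempty: "v \<in> B \<union> W \<Longrightarrow> f \<in> gE v \<Longrightarrow> f \<noteq> {}"
    and distinct_bnd: "v \<in> B \<union> W \<Longrightarrow> distinct (bnd v)"
    and bij_pos: "v \<in> B \<union> W \<Longrightarrow>
      bij_betw (\<lambda>(e, i). p v e i) (SIGMA e:{e\<in>E. v = src e \<or> v = tgt e}. {..<n (tgt e)})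
        {..<length (bnd v)}"
begin

definition mid :: "'e \<Rightarrow> nat \<Rightarrow> ('v \<times> 'u) set" where
  "mid e i = {(src e, bnd (src e) ! p (src e) e i), (tgt e, bnd (tgt e) ! p (tgt e) e i)}"

definition mids :: "('v \<times> 'u) set set" where
  "mids = {mid e i | e i. e \<in> E \<and> i < n (tgt e)}"

definition inc :: "'v \<Rightarrow> 'e set" where
  "inc v = {e\<in>E. v = src e \<or> v = tgt e}"

text \<open>\<open>U e\<close> is the set of indices of the middle edges over \<open>e\<close> that a dimer cover does not use;
  their ends are the boundary vertices covered inside the gadgets.\<close>

definition used :: "'v \<Rightarrow> ('e \<Rightarrow> nat set) \<Rightarrow> nat set" where
  "used v U = (\<Union>e\<in>inc v. p v e ` U e)"

text \<open>The index set of the sum in \<open>gadget_sum\<close>.\<close>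

definition matchings :: "'v \<Rightarrow> nat set \<Rightarrow> 'u set set set" where
  "matchings v I = {M. M \<subseteq> gE v \<and> (\<forall>x\<in>gV v. card {e\<in>M. x \<in> e} =
          (if x \<in> set (bnd v) \<and> x \<notin> (\<lambda>i. bnd v ! i) ` I then 0 else 1))}"

definition glue :: "('e \<Rightarrow> nat set) \<Rightarrow> ('v \<Rightarrow> 'u set set) \<Rightarrow> ('v \<times> 'u) set set" where
  "glue U F = {mid e i | e i. e \<in> E \<and> i < n (tgt e) \<and> i \<notin> U e} \<union> (\<Union>v\<in>B \<union> W. (`) (Pair v) ` F v)"

definition free :: "('v \<times> 'u) set set \<Rightarrow> 'e \<Rightarrow> nat set" where
  "free \<pi> = (\<lambda>e\<in>E. {i. i < n (tgt e) \<and> mid e i \<notin> \<pi>})"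

definition local :: "('v \<times> 'u) set set \<Rightarrow> 'v \<Rightarrow> 'u set set" where
  "local \<pi> = (\<lambda>v\<in>B \<union> W. {f \<in> gE v. Pair v ` f \<in> \<pi>})"

abbreviation slots :: "('e \<Rightarrow> nat set) set" where
  "slots \<equiv> PiE E (\<lambda>e. Pow {..<n (tgt e)})"

section \<open>The correspondence between dimer covers and local matchings\<close>

lemma src_neq_tgt: "e \<in> E \<Longrightarrow> src e \<noteq> tgt e"
proof
  assume "e \<in> E" "src e = tgt e"
  then have "src e \<in> B \<inter> W" using src[of e] tgt[of e] by simp
  then show False using BW by simp
qed

lemma inj_image_Pair: "Pair v ` f = Pair v' ` f' \<Longrightarrow> f \<noteq> {} \<Longrightarrow> v = v' \<and> f = f'"
proof
  assume eq: "Pair v ` f = Pair v' ` f'" and "f \<noteq> {}"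
  then obtain x where "x \<in> f" by blast
  then have "(v, x) \<in> Pair v' ` f'" using eq by blast
  then show "v = v'" by blast
  have "f = snd ` Pair v ` f" "f' = snd ` Pair v' ` f'" by (simp_all add: image_image)
  then show "f = f'" using eq by simp
qed

lemma finite_gE: "v \<in> B \<union> W \<Longrightarrow> finite (gE v)"
proof -
  assume v: "v \<in> B \<union> W"
  then have "gE v \<subseteq> Pow (gV v)" using gE_subset[OF v] by blast
  then show ?thesis by (rule finite_subset) (simp add: finite_gV[OF v])
qed

lemma pos_unique:
  assumes "v \<in> B \<union> W" "e \<in> inc v" "e' \<in> inc v" "i < n (tgt e)" "i' < n (tgt e')"
    and "p v e i = p v e' i'"
  shows "e = e' \<and> i = i'"
proof -
  have "inj_on (\<lambda>(e, i). p v e i) (SIGMA e:inc v. {..<n (tgt e)})"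
    using bij_pos[OF assms(1)] by (simp add: bij_betw_def inc_def)
  from inj_onD[OF this, of "(e, i)" "(e', i')"] assms show ?thesis by auto
qed

lemma pos_less: "v \<in> B \<union> W \<Longrightarrow> e \<in> inc v \<Longrightarrow> i < n (tgt e) \<Longrightarrow> p v e i < length (bnd v)"
proof -
  assume "v \<in> B \<union> W" "e \<in> inc v" "i < n (tgt e)"
  then show ?thesis using bij_betw_apply[OF bij_pos[of v], of "(e, i)"] by (simp add: inc_def)
qed

lemma pos_exhaust:
  assumes "v \<in> B \<union> W" "j < length (bnd v)"
  obtains e i where "e \<in> inc v" "i < n (tgt e)" "j = p v e i"
proof -
  have "j \<in> (\<lambda>(e, i). p v e i) ` (SIGMA e:inc v. {..<n (tgt e)})"
    using bij_pos[OF assms(1)] assms(2) by (simp add: bij_betw_def inc_def)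
  then show ?thesis using that by auto
qed

text \<open>The end in \<open>B\<close> already determines the edge and the index by uniqueness of
  positions; disjointness of \<open>B\<close> and \<open>W\<close> keeps the two ends from matching
  crosswise.\<close>

lemma mid_inject:
  assumes "e \<in> E" "e' \<in> E" "i < n (tgt e)" "i' < n (tgt e')" "mid e i = mid e' i'"
  shows "e = e' \<and> i = i'"
proof -
  have eq: "src e = src e'" "bnd (src e) ! p (src e) e i = bnd (src e) ! p (src e) e' i'"
    using assms(5) src[OF assms(1)] tgt[OF assms(1)] src[OF assms(2)] tgt[OF assms(2)] BW
    by (auto simp: mid_def doubleton_eq_iff)
  have b: "src e \<in> B \<union> W" using src[OF assms(1)] by simp
  have inc: "e \<in> inc (src e)" "e' \<in> inc (src e)" using assms eq by (auto simp: inc_def)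
  have "p (src e) e i = p (src e) e' i'"
    using eq(2) distinct_bnd[OF b] pos_less[OF b inc(1) assms(3)] pos_less[OF b inc(2) assms(4)]
    by (simp add: nth_eq_iff_index_eq)
  then show ?thesis using pos_unique[OF b inc assms(3,4)] by simp
qed

lemma fst_image_mid: "fst ` mid e i = {src e, tgt e}"
  by (auto simp: mid_def)

text \<open>A middle edge meets two gadgets, the copy of a gadget edge at most one.\<close>

lemma mid_neq_inner: "e \<in> E \<Longrightarrow> mid e i \<noteq> Pair v ` f"
proof
  assume e: "e \<in> E" and "mid e i = Pair v ` f"
  then have "{src e, tgt e} = fst ` Pair v ` f" using fst_image_mid by metis
  also have "\<dots> \<subseteq> {v}" by auto
  finally show False using src_neq_tgt[OF e] by auto
qed

lemma mid_mem_glue: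
  assumes "e \<in> E" "i < n (tgt e)"
  shows "mid e i \<in> glue U F \<longleftrightarrow> i \<notin> U e"
proof
  assume "mid e i \<in> glue U F"
  then consider e' i' where "mid e i = mid e' i'" "e' \<in> E" "i' < n (tgt e')" "i' \<notin> U e'"
    | v f where "mid e i = Pair v ` f"
    unfolding glue_def by blast
  then show "i \<notin> U e"
  proof cases
    case 1
    then show ?thesis using mid_inject[OF assms(1) 1(2) assms(2) 1(3) 1(1)] by simp
  next
    case 2
    then show ?thesis using mid_neq_inner[OF assms(1)] by blast
  qed
qed (use assms in \<open>unfold glue_def, blast\<close>)

lemma inner_mem_glue:
  assumes "v \<in> B \<union> W" "f \<noteq> {}"
  shows "Pair v ` f \<in> glue U F \<longleftrightarrow> f \<in> F v"
proof
  assume "Pair v ` f \<in> glue U F"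
  then consider e i where "e \<in> E" "Pair v ` f = mid e i"
    | v' f' where "Pair v ` f = Pair v' ` f'" "f' \<in> F v'"
    unfolding glue_def by blast
  then show "f \<in> F v"
  proof cases
    case 1
    then show ?thesis using mid_neq_inner[of e i v f] by simp
  next
    case 2
    then show ?thesis using inj_image_Pair[OF _ assms(2), of v v' f'] by simp
  qed
qed (use assms(1) in \<open>unfold glue_def, blast\<close>)

lemma free_glue: "U \<in> slots \<Longrightarrow> free (glue U F) = U"
proof (rule ext)
  fix e assume U: "U \<in> slots"
  show "free (glue U F) e = U e"
  proof (cases "e \<in> E")
    case True
    then have "U e \<subseteq> {..<n (tgt e)}" using U by (auto simp: PiE_def Pi_def)
    then show ?thesis using True by (auto simp: free_def mid_mem_glue)
  qed (use U in \<open>auto simp: free_def PiE_def extensional_def\<close>)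
qed

lemma local_glue:
  assumes "F \<in> PiE (B \<union> W) (\<lambda>v. Pow (gE v))"
  shows "local (glue U F) = F"
proof (rule ext)
  fix v show "local (glue U F) v = F v"
  proof (cases "v \<in> B \<union> W")
    case True
    then have "F v \<subseteq> gE v" using assms by auto
    then show ?thesis using True inner_mem_glue[OF True] gE_nonempty[OF True]
      by (auto simp: local_def)
  qed (use assms in \<open>auto simp: local_def PiE_def extensional_def\<close>)
qed

lemma glue_free_local:
  assumes "\<pi> \<subseteq> inner_edges B W gE \<union> mids"
  shows "glue (free \<pi>) (local \<pi>) = \<pi>"
proof (intro equalityI subsetI)
  fix d assume d: "d \<in> \<pi>"
  then consider v f where "d = Pair v ` f" "v \<in> B \<union> W" "f \<in> gE v"
    | e i where "d = mid e i" "e \<in> E" "i < n (tgt e)"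
    using assms by (auto simp: inner_edges_def mids_def)
  then show "d \<in> glue (free \<pi>) (local \<pi>)"
  proof cases
    case 1
    then have "f \<in> local \<pi> v" using d by (simp add: local_def)
    then show ?thesis using 1 unfolding glue_def by blast
  next
    case 2
    then have "i \<notin> free \<pi> e" using d by (simp add: free_def)
    then show ?thesis using 2 unfolding glue_def by blast
  qed
qed (auto simp: glue_def free_def local_def)

lemma glue_subset:
  assumes "\<And>v. v \<in> B \<union> W \<Longrightarrow> F v \<subseteq> gE v"
  shows "glue U F \<subseteq> inner_edges B W gE \<union> mids"
  using assms unfolding glue_def inner_edges_def mids_def by blast

text \<open>By \<open>bij_pos\<close> each boundary vertex is the end of exactly one middle edge,
  say number i over e, and \<open>glue U F\<close> contains it unless i is in \<open>U e\<close>. So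
  precisely the boundary vertices outside \<open>used v U\<close> receive an edge from outside the
  gadget.\<close>

lemma card_glue_at:
  assumes v: "v \<in> B \<union> W" and F: "\<And>v. v \<in> B \<union> W \<Longrightarrow> F v \<subseteq> gE v" and U: "U \<in> slots"
  shows "card {d \<in> glue U F. (v, x) \<in> d} = card {f \<in> F v. x \<in> f}
     + (if x \<in> set (bnd v) \<and> x \<notin> (\<lambda>i. bnd v ! i) ` used v U then 1 else 0)"
proof -
  let ?in = "(`) (Pair v) ` {f \<in> F v. x \<in> f}"
  let ?mid = "{mid e i | e i. e \<in> inc v \<and> i < n (tgt e) \<and> i \<notin> U e \<and> bnd v ! p v e i = x}"
  have finF: "finite (F v)" using F[OF v] finite_gE[OF v] finite_subset by blast
  have at: "(v, x) \<in> mid e i \<longleftrightarrow> e \<in> inc v \<and> bnd v ! p v e i = x" if "e \<in> E" for e i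
    using that src_neq_tgt[OF that] by (auto simp: mid_def inc_def)
  have eq: "{d \<in> glue U F. (v, x) \<in> d} = ?in \<union> ?mid"
  proof (intro equalityI subsetI)
    fix d assume "d \<in> {d \<in> glue U F. (v, x) \<in> d}"
    then consider e i where "d = mid e i" "e \<in> E" "i < n (tgt e)" "i \<notin> U e" "(v, x) \<in> mid e i"
      | f where "d = Pair v ` f" "f \<in> F v" "x \<in> f"
      unfolding glue_def by blast
    then show "d \<in> ?in \<union> ?mid"
      by cases (use at in auto)
  next
    fix d assume "d \<in> ?in \<union> ?mid"
    then consider e i where "d = mid e i" "e \<in> inc v" "i < n (tgt e)" "i \<notin> U e" "bnd v ! p v e i = x"
      | f where "d = Pair v ` f" "f \<in> F v" "x \<in> f"
      by blast
    then show "d \<in> {d \<in> glue U F. (v, x) \<in> d}"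
    proof cases
      case 1
      then have "e \<in> E" by (simp add: inc_def)
      then show ?thesis using 1 at unfolding glue_def by blast
    next
      case 2
      then show ?thesis using v unfolding glue_def by blast
    qed
  qed
  have disj: "?in \<inter> ?mid = {}"
  proof (rule equals0I)
    fix d assume "d \<in> ?in \<inter> ?mid"
    then obtain e i f where "e \<in> inc v" "d = mid e i" "d = Pair v ` f" by blast
    then show False using mid_neq_inner[of e i v f] by (simp add: inc_def)
  qed
  have mid: "finite ?mid \<and> card ?mid
      = (if x \<in> set (bnd v) \<and> x \<notin> (\<lambda>i. bnd v ! i) ` used v U then 1 else 0)"
  proof (cases "x \<in> set (bnd v)")
    case False
    then have "?mid = {}" using pos_less[OF v] by auto
    then show ?thesis using False by (simp only: if_False simp_thms card.empty finite.emptyI)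
  next
    case True
    then obtain j where "j < length (bnd v)" "bnd v ! j = x" by (auto simp: in_set_conv_nth)
    then obtain e i where ei: "e \<in> inc v" "i < n (tgt e)" "bnd v ! p v e i = x"
      using pos_exhaust[OF v] by metis
    have uniq: "e' = e \<and> i' = i" if "e' \<in> inc v" "i' < n (tgt e')" "bnd v ! p v e' i' = x" for e' i'
    proof -
      have "p v e' i' = p v e i"
        using that ei distinct_bnd[OF v] pos_less[OF v that(1,2)] pos_less[OF v ei(1,2)]
        by (metis nth_eq_iff_index_eq)
      then show ?thesis using pos_unique[OF v that(1) ei(1) that(2) ei(2)] by simp
    qed
    \<comment> \<open>Indices taken from \<open>used\<close> are in range because \<open>U\<close>
      is in \<open>slots\<close>; hence \<open>uniq\<close> applies to them too.\<close>
    have sub: "i' < n (tgt e')" if "e' \<in> inc v" "i' \<in> U e'" for e' i'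
      using that U by (auto simp: inc_def PiE_def Pi_def)
    have "x \<in> (\<lambda>i. bnd v ! i) ` used v U \<longleftrightarrow> i \<in> U e"
    proof
      assume "x \<in> (\<lambda>i. bnd v ! i) ` used v U"
      then obtain e' i' where "e' \<in> inc v" "i' \<in> U e'" "bnd v ! p v e' i' = x"
        by (auto simp: used_def)
      then show "i \<in> U e" using uniq[of e' i'] sub by auto
    next
      assume "i \<in> U e"
      then show "x \<in> (\<lambda>i. bnd v ! i) ` used v U" using ei by (auto simp: used_def)
    qed
    moreover have "?mid = (if i \<in> U e then {} else {mid e i})"
    proof (intro equalityI subsetI)
      fix d assume "d \<in> ?mid"
      then obtain e' i' where "d = mid e' i'" "e' \<in> inc v" "i' < n (tgt e')" "i' \<notin> U e'"
        "bnd v ! p v e' i' = x" by blast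
      then show "d \<in> (if i \<in> U e then {} else {mid e i})" using uniq[of e' i'] by simp
    next
      fix d assume "d \<in> (if i \<in> U e then {} else {mid e i})"
      then have "d = mid e i" "i \<notin> U e" by (auto split: if_splits)
      then show "d \<in> ?mid" using ei by blast
    qed
    ultimately show ?thesis using True by simp
  qed
  have "inj_on ((`) (Pair v)) {f \<in> F v. x \<in> f}"
    by (rule inj_on_image) (auto simp: inj_on_def)
  then have "card ?in = card {f \<in> F v. x \<in> f}" by (rule card_image)
  then show ?thesis unfolding eq using card_Un_disjoint[OF _ _ disj] mid finF by simp
qed

text \<open>Degree 1 in the glued graph, less the contribution of the middle edge, is the degree
  prescribed by \<open>matchings\<close>.\<close>

lemma glue_dimer_iff:
  assumes F: "\<And>v. v \<in> B \<union> W \<Longrightarrow> F v \<subseteq> gE v" and U: "U \<in> slots"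
  shows "glue U F \<in> dimer_covers (hat_V B W gV) (inner_edges B W gE \<union> mids)
     \<longleftrightarrow> (\<forall>v\<in>B \<union> W. F v \<in> matchings v (used v U))"
proof -
  have "glue U F \<in> dimer_covers (hat_V B W gV) (inner_edges B W gE \<union> mids)
     \<longleftrightarrow> (\<forall>v\<in>B \<union> W. \<forall>x\<in>gV v. card {d \<in> glue U F. (v, x) \<in> d} = 1)"
    using glue_subset[OF F] by (auto simp: dimer_covers_def hat_V_def)
  also have "\<dots> \<longleftrightarrow> (\<forall>v\<in>B \<union> W. \<forall>x\<in>gV v. card {f \<in> F v. x \<in> f} =
     (if x \<in> set (bnd v) \<and> x \<notin> (\<lambda>i. bnd v ! i) ` used v U then 0 else 1))"
    by (intro ball_cong refl, subst card_glue_at[OF _ F U]) auto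
  also have "\<dots> \<longleftrightarrow> (\<forall>v\<in>B \<union> W. F v \<in> matchings v (used v U))"
    using F by (auto simp: matchings_def)
  finally show ?thesis .
qed

text \<open>\<open>hat_wt\<close> sees how many gadgets an edge meets: two for a middle edge, which
  weighs 1, and one for a gadget edge, which keeps its weight.\<close>

lemma prod_hat_wt_glue:
  assumes F: "\<And>v. v \<in> B \<union> W \<Longrightarrow> F v \<subseteq> gE v"
  shows "(\<Prod>d\<in>glue U F. hat_wt gw d) = (\<Prod>v\<in>B \<union> W. \<Prod>f\<in>F v. gw v f)"
proof -
  let ?mid = "{mid e i | e i. e \<in> E \<and> i < n (tgt e) \<and> i \<notin> U e}"
  have finF: "finite (F v)" if "v \<in> B \<union> W" for v
    using F[OF that] finite_gE[OF that] finite_subset by blast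
  have ne: "f \<noteq> {}" if "v \<in> B \<union> W" "f \<in> F v" for v f
    using that F gE_nonempty by blast
  have "?mid = (\<lambda>(e,i). mid e i) ` (SIGMA e:E. {i. i < n (tgt e) \<and> i \<notin> U e})" by auto
  then have finm: "finite ?mid" using fin by simp
  have one: "hat_wt gw d = 1" if "d \<in> ?mid" for d
    using that src_neq_tgt by (auto simp: hat_wt_def fst_image_mid)
  have "(\<Prod>d\<in>glue U F. hat_wt gw d) = (\<Prod>d\<in>?mid. hat_wt gw d)
      * (\<Prod>d\<in>(\<Union>v\<in>B \<union> W. (`) (Pair v) ` F v). hat_wt gw d)"
    unfolding glue_def
  proof (rule prod.union_disjoint)
    show "?mid \<inter> (\<Union>v\<in>B \<union> W. (`) (Pair v) ` F v) = {}"
    proof (rule equals0I)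
      fix d assume "d \<in> ?mid \<inter> (\<Union>v\<in>B \<union> W. (`) (Pair v) ` F v)"
      then obtain e i v f where "e \<in> E" "d = mid e i" "d = Pair v ` f" by blast
      then show False using mid_neq_inner[of e i v f] by simp
    qed
  qed (use finm fin finF in auto)
  also have "(\<Prod>d\<in>?mid. hat_wt gw d) = 1" by (rule prod.neutral) (use one in blast)
  also have "(\<Prod>d\<in>(\<Union>v\<in>B \<union> W. (`) (Pair v) ` F v). hat_wt gw d)
     = (\<Prod>v\<in>B \<union> W. \<Prod>d\<in>(`) (Pair v) ` F v. hat_wt gw d)"
  proof (rule prod.UNION_disjoint)
    show "\<forall>i\<in>B \<union> W. \<forall>j\<in>B \<union> W. i \<noteq> j \<longrightarrow> (`) (Pair i) ` F i \<inter> (`) (Pair j) ` F j = {}"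
    proof (intro ballI impI equals0I)
      fix v v' d assume v: "v \<in> B \<union> W" "v \<noteq> v'"
        and "d \<in> (`) (Pair v) ` F v \<inter> (`) (Pair v') ` F v'"
      then obtain f f' where "f \<in> F v" "Pair v ` f = Pair v' ` f'" by auto
      then show False using inj_image_Pair[of v f v' f'] ne v by blast
    qed
  qed (use fin finF in auto)
  also have "\<dots> = (\<Prod>v\<in>B \<union> W. \<Prod>f\<in>F v. gw v f)"
  proof (rule prod.cong[OF refl])
    fix v assume v: "v \<in> B \<union> W"
    have "inj_on ((`) (Pair v)) (F v)"
      by (rule inj_on_image) (auto simp: inj_on_def)
    then have "(\<Prod>d\<in>(`) (Pair v) ` F v. hat_wt gw d) = (\<Prod>f\<in>F v. hat_wt gw (Pair v ` f))"
      by (simp add: prod.reindex)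
    also have "\<dots> = (\<Prod>f\<in>F v. gw v f)"
    proof (rule prod.cong[OF refl])
      fix f assume "f \<in> F v"
      then have "fst ` Pair v ` f = {v}" "snd ` Pair v ` f = f"
        using ne[OF v] by (auto simp: image_image)
      then show "hat_wt gw (Pair v ` f) = gw v f" by (simp add: hat_wt_def)
    qed
    finally show "(\<Prod>d\<in>(`) (Pair v) ` F v. hat_wt gw d) = (\<Prod>f\<in>F v. gw v f)" .
  qed
  finally show ?thesis by simp
qed

text \<open>A product of gadget sums is a sum over families of matchings, and \<open>glue\<close> is
  a weight-preserving bijection with inverse given by \<open>free\<close> and \<open>local\<close>.
  The predicate \<open>P\<close> passes through it unchanged; the theorem lets it prescribe the
  sizes \<open>m e\<close>.\<close>

lemma sum_dimer_covers:
  "(\<Sum>\<pi>\<in>{\<pi> \<in> dimer_covers (hat_V B W gV) (inner_edges B W gE \<union> mids). P (free \<pi>)}. \<Prod>d\<in>\<pi>. hat_wt gw d)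
   = (\<Sum>U\<in>{U \<in> slots. P U}. \<Prod>v\<in>B \<union> W. gadget_sum gV gE gw bnd v (used v U))"
proof -
  let ?C = "dimer_covers (hat_V B W gV) (inner_edges B W gE \<union> mids)"
  let ?M = "\<lambda>U. PiE (B \<union> W) (\<lambda>v. matchings v (used v U))"
  have finM: "finite (matchings v I)" if "v \<in> B \<union> W" for v I
    using finite_gE[OF that] by (auto simp: matchings_def)
  have finS: "finite slots" using fin by (intro finite_PiE) auto
  have "(\<Sum>U\<in>{U \<in> slots. P U}. \<Prod>v\<in>B \<union> W. gadget_sum gV gE gw bnd v (used v U))
     = (\<Sum>U\<in>{U \<in> slots. P U}. \<Sum>F\<in>?M U. \<Prod>v\<in>B \<union> W. \<Prod>f\<in>F v. gw v f)"
    unfolding gadget_sum_def matchings_def[symmetric] using fin finM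
    by (intro sum.cong refl prod_sum_PiE) auto
  also have "\<dots> = (\<Sum>(U, F)\<in>(SIGMA U:{U \<in> slots. P U}. ?M U). \<Prod>v\<in>B \<union> W. \<Prod>f\<in>F v. gw v f)"
    using finS fin finM by (intro sum.Sigma) (auto intro!: finite_PiE)
  also have "\<dots> = (\<Sum>\<pi>\<in>{\<pi> \<in> ?C. P (free \<pi>)}. \<Prod>d\<in>\<pi>. hat_wt gw d)"
  proof (rule sum.reindex_bij_witness[of _ "\<lambda>\<pi>. (free \<pi>, local \<pi>)" "\<lambda>(U, F). glue U F"], goal_cases)
    case (1 q)
    then obtain U F where q: "q = (U, F)" "U \<in> slots" "F \<in> ?M U" by auto
    then have "F \<in> PiE (B \<union> W) (\<lambda>v. Pow (gE v))" by (auto simp: matchings_def PiE_def Pi_def)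
    then show ?case using q by (simp add: free_glue local_glue)
  next
    case (2 q)
    then obtain U F where q: "q = (U, F)" "U \<in> slots" "F \<in> ?M U" "P U" by auto
    then have "v \<in> B \<union> W \<Longrightarrow> F v \<subseteq> gE v" for v by (auto simp: matchings_def PiE_def Pi_def)
    from glue_dimer_iff[OF this q(2)] have "glue U F \<in> ?C" using q(3) by auto
    then show ?case using q by (simp add: free_glue)
  next
    case (3 \<pi>)
    then have "\<pi> \<subseteq> inner_edges B W gE \<union> mids" by (auto simp: dimer_covers_def)
    then show ?case by (simp add: glue_free_local)
  next
    case (4 \<pi>)
    then have sub: "\<pi> \<subseteq> inner_edges B W gE \<union> mids" and \<pi>: "\<pi> \<in> ?C" "P (free \<pi>)"
      by (auto simp: dimer_covers_def)
    have free: "free \<pi> \<in> slots" by (auto simp: free_def)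
    have "local \<pi> v \<subseteq> gE v" if "v \<in> B \<union> W" for v using that by (auto simp: local_def)
    from glue_dimer_iff[OF this free] have "\<forall>v\<in>B \<union> W. local \<pi> v \<in> matchings v (used v (free \<pi>))"
      using \<pi> glue_free_local[OF sub] by simp
    then have "local \<pi> \<in> ?M (free \<pi>)" by (auto simp: local_def)
    then show ?case using free \<pi> by simp
  next
    case (5 q)
    then obtain U F where q: "q = (U, F)" "F \<in> ?M U" by auto
    then have "v \<in> B \<union> W \<Longrightarrow> F v \<subseteq> gE v" for v by (auto simp: matchings_def PiE_def Pi_def)
    then show ?case using q prod_hat_wt_glue[of F U] by simp
  qed
  finally show ?thesis by simp
qed

end

section \<open>Colourings and traces\<close>

lemma card_blocks:
  assumes "distinct xs" "\<And>u. u \<in> set xs \<Longrightarrow> U u \<subseteq> {..<k u}"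
  shows "card (\<Union>u\<in>set xs. (+) (blk_off k xs u) ` U u) = (\<Sum>u\<in>set xs. card (U u))"
proof -
  have "card (\<Union>u\<in>set xs. (+) (blk_off k xs u) ` U u)
      = length (sorted_list_of_set (\<Union>u\<in>set xs. (+) (blk_off k xs u) ` U u))"
    by (simp only: length_sorted_list_of_set)
  also have "\<dots> = length (concat (map (\<lambda>u. map ((+) (blk_off k xs u)) (sorted_list_of_set (U u))) xs))"
    by (simp only: sorted_list_of_set_blocks[OF assms])
  also have "\<dots> = (\<Sum>u\<in>set xs. card (U u))"
    using assms(1) by (simp add: length_concat comp_def sum_list_distinct_conv_sum_set)
  finally show ?thesis .
qed

lemma blocks_subset:
  assumes "distinct xs" "\<And>u. u \<in> set xs \<Longrightarrow> U u \<subseteq> {..<k u}"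
  shows "(\<Union>u\<in>set xs. (+) (blk_off k xs u) ` U u) \<subseteq> {..<sum_list (map k xs)}"
proof
  fix j assume "j \<in> (\<Union>u\<in>set xs. (+) (blk_off k xs u) ` U u)"
  then obtain u i where "u \<in> set xs" "i \<in> U u" "j = blk_off k xs u + i" by blast
  then show "j \<in> {..<sum_list (map k xs)}"
    using assms(2)[of u] bij_betw_apply[OF bij_betw_blk_off[OF assms(1), of k], of "(u, i)"] by auto
qed

text \<open>The columns are all colours of a vertex, so each concatenation of parts permutes them
  and \<open>list_rsgn\<close> becomes \<open>list_sign\<close>. White vertices use this on the
  transpose of \<open>M w\<close>.\<close>

lemma lminor_blocks:
  assumes "distinct xs" "\<And>u. u \<in> set xs \<Longrightarrow> U u \<subseteq> {..<k u}"
  shows "lminor A (sorted_list_of_set (\<Union>u\<in>set xs. (+) (blk_off k xs u) ` U u)) {..<N}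
     = (\<Sum>s\<in>set_parts (set xs) (\<lambda>u. card (U u)) {..<N}.
         list_sign (concat (map (\<lambda>u. sorted_list_of_set (s u)) xs))
         * (\<Prod>u\<in>set xs. lminor (\<lambda>i j. A (blk_off k xs u + i) j) (sorted_list_of_set (U u)) (s u)))"
proof -
  let ?R = "\<lambda>u. map ((+) (blk_off k xs u)) (sorted_list_of_set (U u))"
  have "lminor A (sorted_list_of_set (\<Union>u\<in>set xs. (+) (blk_off k xs u) ` U u)) {..<N}
      = lminor A (concat (map ?R xs)) {..<N}"
    by (simp only: sorted_list_of_set_blocks[OF assms])
  also have "\<dots> = (\<Sum>s\<in>set_parts (set xs) (\<lambda>u. card (U u)) {..<N}.
     list_rsgn (concat (map (\<lambda>x. sorted_list_of_set (s x)) xs)) * (\<Prod>x\<in>set xs. lminor A (?R x) (s x)))"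
    by (subst lminor_concat[OF assms(1)]) simp_all
  also have "\<dots> = (\<Sum>s\<in>set_parts (set xs) (\<lambda>u. card (U u)) {..<N}.
     list_sign (concat (map (\<lambda>x. sorted_list_of_set (s x)) xs)) * (\<Prod>x\<in>set xs. lminor A (?R x) (s x)))"
  proof (intro sum.cong refl arg_cong2[of _ _ _ _ "(*)"])
    fix s assume s: "s \<in> set_parts (set xs) (\<lambda>u. card (U u)) {..<N}"
    let ?L = "concat (map (\<lambda>x. sorted_list_of_set (s x)) xs)"
    have "finite (s x)" if "x \<in> set xs" for x
    proof (rule finite_subset)
      show "s x \<subseteq> {..<N}" using s that unfolding set_parts_def by blast
    qed simp
    then have L: "distinct ?L" "set ?L = {..<N}"
      using distinct_concat_parts[OF assms(1), of s] s unfolding set_parts_def by simp_all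
    then have "length ?L = N" using distinct_card[OF L(1)] by simp
    then show "list_rsgn ?L = list_sign ?L"
      using L by (intro list_sign_eq_list_rsgn[symmetric]) simp_all
  qed
  finally show ?thesis by (simp add: lminor_map)
qed

text \<open>\<open>mk v u\<close> is the edge joining \<open>v\<close> to its neighbour \<open>u\<close>; it abstracts from the colour of \<open>v\<close>.\<close>

lemma prod_sum_edge_labels:
  fixes mk :: "'v \<Rightarrow> 'v \<Rightarrow> 'e" and X :: "'v \<Rightarrow> ('v \<Rightarrow> 'c set) set" and g :: "'v \<Rightarrow> ('v \<Rightarrow> 'c set) \<Rightarrow> real"
  assumes V: "finite V" and X: "\<And>v. v \<in> V \<Longrightarrow> finite (X v)" "\<And>v. v \<in> V \<Longrightarrow> X v \<subseteq> extensional (N v)"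
    and E: "E = {mk v u | v u. v \<in> V \<and> u \<in> N v}"
    and mk: "\<And>v u. fr (mk v u) = v" "\<And>v u. ot (mk v u) = u"
  shows "(\<Sum>S\<in>{S. (\<forall>e. e \<notin> E \<longrightarrow> S e = {}) \<and> (\<forall>v\<in>V. (\<lambda>u\<in>N v. S (mk v u)) \<in> X v)}.
      \<Prod>v\<in>V. g v (\<lambda>u\<in>N v. S (mk v u))) = (\<Prod>v\<in>V. \<Sum>s\<in>X v. g v s)"
proof -
  have mem: "mk v u \<in> E \<longleftrightarrow> v \<in> V \<and> u \<in> N v" for v u
    using mk by (auto simp: E) metis+
  \<comment> \<open>The edge labelling built from \<open>F\<close> returns \<open>F v\<close> at
    every vertex; outside \<open>N v\<close> this holds because \<open>F v\<close> is
    extensional.\<close>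
  have eq: "(\<lambda>u\<in>N v. if mk v u \<in> E then F (fr (mk v u)) (ot (mk v u)) else {}) = F v"
    if "F \<in> PiE V X" "v \<in> V" for F v
  proof -
    have "F v \<in> extensional (N v)" using that X(2) by blast
    then show ?thesis using that by (auto simp: mem mk fun_eq_iff extensional_def restrict_def)
  qed
  have "(\<Prod>v\<in>V. \<Sum>s\<in>X v. g v s) = (\<Sum>F\<in>PiE V X. \<Prod>v\<in>V. g v (F v))"
    by (rule prod_sum_PiE[OF V X(1)])
  also have "\<dots> = (\<Sum>S\<in>{S. (\<forall>e. e \<notin> E \<longrightarrow> S e = {}) \<and> (\<forall>v\<in>V. (\<lambda>u\<in>N v. S (mk v u)) \<in> X v)}.
      \<Prod>v\<in>V. g v (\<lambda>u\<in>N v. S (mk v u)))"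
  proof (rule sum.reindex_bij_witness[of _ "\<lambda>S. \<lambda>v\<in>V. \<lambda>u\<in>N v. S (mk v u)"
        "\<lambda>F e. if e \<in> E then F (fr e) (ot e) else {}"], goal_cases)
    case (1 F)
    show ?case
    proof (rule ext)
      fix v show "(\<lambda>v\<in>V. \<lambda>u\<in>N v. if mk v u \<in> E then F (fr (mk v u)) (ot (mk v u)) else {}) v = F v"
        using eq[OF 1] 1 by (cases "v \<in> V") (auto simp: PiE_def extensional_def)
    qed
  next
    case (2 F)
    then show ?case using eq[OF 2] by auto
  next
    case (3 S)
    show ?case
    proof (rule ext)
      fix e
      show "(if e \<in> E then (\<lambda>v\<in>V. \<lambda>u\<in>N v. S (mk v u)) (fr e) (ot e) else {}) = S e"
      proof (cases "e \<in> E")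
        case True
        then obtain v u where "e = mk v u" "v \<in> V" "u \<in> N v" by (auto simp: E)
        then show ?thesis using True by (simp add: mk)
      qed (use 3 in simp)
    qed
  next
    case (4 S)
    then show ?case by auto
  next
    case (5 F)
    then show ?case using eq[OF 5] by (intro prod.cong refl) simp
  qed
  finally show ?thesis by simp
qed

text \<open>A colouring \<open>(S, T)\<close> splits into independent conditions on \<open>S\<close> (black vertices) and on \<open>T\<close>
  (white vertices); both have this shape.\<close>

definition half_colorings ::
  "'v set \<Rightarrow> 'e set \<Rightarrow> ('v \<Rightarrow> 'v set) \<Rightarrow> ('v \<Rightarrow> 'v \<Rightarrow> 'e) \<Rightarrow> ('v \<Rightarrow> nat) \<Rightarrow> ('e \<Rightarrow> nat) \<Rightarrow> ('e \<Rightarrow> nat set) set"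
  where "half_colorings V E ns mk n m = {S. (\<forall>e. e \<notin> E \<longrightarrow> S e = {}) \<and>
     (\<forall>v\<in>V. (\<lambda>u\<in>ns v. S (mk v u)) \<in> set_parts (ns v) (\<lambda>u. m (mk v u)) {..<n v})}"

lemma restrict_mem_set_parts_iff:
  "restrict s X \<in> set_parts X k S \<longleftrightarrow>
     (\<forall>x\<in>X. s x \<subseteq> S \<and> card (s x) = k x) \<and> (\<forall>x\<in>X. \<forall>y\<in>X. x \<noteq> y \<longrightarrow> s x \<inter> s y = {}) \<and> (\<Union>x\<in>X. s x) = S"
  by (simp add: mem_set_parts_iff)

lemma colorings_eq_Times:
  assumes "E \<subseteq> B \<times> W"
  shows "colorings B W E n m = half_colorings B E (\<lambda>b. {w. (b,w) \<in> E}) (\<lambda>b w. (b,w)) n m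
     \<times> half_colorings W E (\<lambda>w. {b. (b,w) \<in> E}) (\<lambda>w b. (b,w)) n m"
proof -
  have "(S, T) \<in> colorings B W E n m \<longleftrightarrow> S \<in> half_colorings B E (\<lambda>b. {w. (b,w) \<in> E}) (\<lambda>b w. (b,w)) n m
     \<and> T \<in> half_colorings W E (\<lambda>w. {b. (b,w) \<in> E}) (\<lambda>w b. (b,w)) n m" (is "?L \<longleftrightarrow> ?R") for S T
  proof
    assume ?L
    then show ?R using assms
      unfolding colorings_def half_colorings_def restrict_mem_set_parts_iff by auto
  next
    assume R: ?R
    \<comment> \<open>Sizes are prescribed per edge in \<open>colorings\<close> but per vertex in
      the halves; as \<open>E\<close> lies in \<open>B \<times> W\<close>, each edge is seen from
      both ends.\<close>
    have "S (b,w) \<subseteq> {..<n b} \<and> card (S (b,w)) = m (b,w) \<and> T (b,w) \<subseteq> {..<n w} \<and> card (T (b,w)) = m (b,w)"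
      if "(b,w) \<in> E" for b w
    proof -
      have "b \<in> B" "w \<in> W" using that assms by auto
      then show ?thesis
        using that R unfolding half_colorings_def restrict_mem_set_parts_iff by simp
    qed
    then show ?L using R
      unfolding colorings_def half_colorings_def restrict_mem_set_parts_iff by auto
  qed
  then show ?thesis by auto
qed

text \<open>Each edge has one distinguished end \<open>fr e\<close> in \<open>V\<close>, so factors
  indexed by a vertex and a neighbour recombine into a product over \<open>E\<close>. Used once for
  \<open>B\<close> and once for \<open>W\<close>.\<close>

lemma prod_half_colorings:
  fixes mk :: "'v \<Rightarrow> 'v \<Rightarrow> 'e"
  assumes V: "finite V" and fin: "\<And>v. v \<in> V \<Longrightarrow> set (ord v) = ns v"
    and E: "E = {mk v u | v u. v \<in> V \<and> u \<in> ns v}"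
    and mk: "\<And>v u. fr (mk v u) = v" "\<And>v u. ot (mk v u) = u"
  shows "(\<Prod>v\<in>V. \<Sum>s\<in>set_parts (ns v) (\<lambda>u. m (mk v u)) {..<n v}.
      list_sign (concat (map (\<lambda>u. sorted_list_of_set (s u)) (ord v))) * (\<Prod>u\<in>ns v. h (mk v u) (s u)))
    = (\<Sum>S\<in>half_colorings V E ns mk n m.
      (\<Prod>v\<in>V. list_sign (concat (map (\<lambda>u. sorted_list_of_set (S (mk v u))) (ord v)))) * (\<Prod>e\<in>E. h e (S e)))"
proof -
  let ?g = "\<lambda>v s. list_sign (concat (map (\<lambda>u. sorted_list_of_set (s u)) (ord v)))
     * (\<Prod>u\<in>ns v. h (mk v u) (s u))"
  have finN: "finite (ns v)" if "v \<in> V" for v using fin[OF that] by (metis List.finite_set)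
  have edges: "(\<Prod>v\<in>V. \<Prod>u\<in>ns v. h (mk v u) (S (mk v u))) = (\<Prod>e\<in>E. h e (S e))" for S
  proof -
    have "(\<Prod>v\<in>V. \<Prod>u\<in>ns v. h (mk v u) (S (mk v u)))
        = (\<Prod>(v,u)\<in>(SIGMA v:V. ns v). h (mk v u) (S (mk v u)))"
      using V finN by (intro prod.Sigma) auto
    also have "\<dots> = (\<Prod>e\<in>E. h e (S e))"
      by (rule prod.reindex_bij_witness[of _ "\<lambda>e. (fr e, ot e)" "\<lambda>(v,u). mk v u"]) (auto simp: mk E)
    finally show ?thesis .
  qed
  have "(\<Prod>v\<in>V. \<Sum>s\<in>set_parts (ns v) (\<lambda>u. m (mk v u)) {..<n v}. ?g v s)
     = (\<Sum>S\<in>half_colorings V E ns mk n m. \<Prod>v\<in>V. ?g v (\<lambda>u\<in>ns v. S (mk v u)))"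
    unfolding half_colorings_def
  proof (rule prod_sum_edge_labels[OF V _ _ E mk, symmetric])
    fix v assume v: "v \<in> V"
    show "finite (set_parts (ns v) (\<lambda>u. m (mk v u)) {..<n v})"
      using finN[OF v] by (rule finite_set_parts) simp
    show "set_parts (ns v) (\<lambda>u. m (mk v u)) {..<n v} \<subseteq> extensional (ns v)"
      unfolding set_parts_def by (auto simp: PiE_def)
  qed
  also have "\<dots> = (\<Sum>S\<in>half_colorings V E ns mk n m.
      (\<Prod>v\<in>V. list_sign (concat (map (\<lambda>u. sorted_list_of_set (S (mk v u))) (ord v))))
      * (\<Prod>v\<in>V. \<Prod>u\<in>ns v. h (mk v u) (S (mk v u))))"
  proof (intro sum.cong refl, unfold prod.distrib[symmetric], intro prod.cong refl arg_cong2[of _ _ _ _ "(*)"])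
    fix S v assume "v \<in> V"
    then show "list_sign (concat (map (\<lambda>u. sorted_list_of_set ((\<lambda>u\<in>ns v. S (mk v u)) u)) (ord v)))
       = list_sign (concat (map (\<lambda>u. sorted_list_of_set (S (mk v u))) (ord v)))"
      using fin by (intro arg_cong[of _ _ list_sign] arg_cong[of _ _ concat] map_cong) auto
  qed simp
  finally show ?thesis by (simp only: edges)
qed

text \<open>Cauchy--Binet for a single edge. The minor of \<open>P\<close> is transposed so that
  \<open>U\<close> lists its rows, the form in which \<open>lminor_blocks\<close> delivers the white
  end.\<close>

lemma det_submatrix_mult:
  assumes P: "P \<in> carrier_mat r k" and Q: "Q \<in> carrier_mat k c"
    and T: "T \<subseteq> {..<r}" and S: "S \<subseteq> {..<c}" and card: "card T = l" "card S = l"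
  shows "det (submatrix (P * Q) T S) = (\<Sum>U\<in>{U. U \<subseteq> {..<k} \<and> card U = l}.
     lminor (\<lambda>j i. P $$ (i, j)) (sorted_list_of_set U) T * lminor (\<lambda>i j. Q $$ (i, j)) (sorted_list_of_set U) S)"
proof -
  have fin: "finite T" "finite S" using T S finite_subset by blast+
  have "det (submatrix (P * Q) T S) = lminor (\<lambda>i j. (P * Q) $$ (i, j)) (sorted_list_of_set T) S"
    using assms by (intro det_submatrix_eq_lminor[of _ r c]) auto
  also have "\<dots> = lminor (\<lambda>i j. \<Sum>u\<in>{..<k}. P $$ (i, u) * Q $$ (u, j)) (sorted_list_of_set T) S"
  proof (rule lminor_cong)
    fix i j assume "i \<in> set (sorted_list_of_set T)" "j \<in> S"
    then have "i < r" "j < c" using fin T S by auto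
    then show "(P * Q) $$ (i, j) = (\<Sum>u\<in>{..<k}. P $$ (i, u) * Q $$ (u, j))"
      using P Q by (simp add: scalar_prod_def lessThan_atLeast0)
  qed
  also have "\<dots> = (\<Sum>U\<in>{U. U \<subseteq> {..<k} \<and> card U = l}.
     lminor (\<lambda>i j. P $$ (i, j)) (sorted_list_of_set T) U * lminor (\<lambda>i j. Q $$ (i, j)) (sorted_list_of_set U) S)"
    using fin card by (subst lminor_mult) simp_all
  also have "\<dots> = (\<Sum>U\<in>{U. U \<subseteq> {..<k} \<and> card U = l}.
     lminor (\<lambda>j i. P $$ (i, j)) (sorted_list_of_set U) T * lminor (\<lambda>i j. Q $$ (i, j)) (sorted_list_of_set U) S)"
  proof (intro sum.cong refl arg_cong2[of _ _ _ _ "(*)"])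
    fix U assume "U \<in> {U. U \<subseteq> {..<k} \<and> card U = l}"
    then show "lminor (\<lambda>i j. P $$ (i, j)) (sorted_list_of_set T) U
       = lminor (\<lambda>j i. P $$ (i, j)) (sorted_list_of_set U) T"
      using fin card finite_subset by (intro lminor_transpose) auto
  qed
  finally show ?thesis .
qed

theorem theorem5:
  fixes B W :: "'v set" and E :: "('v \<times> 'v) set" and n :: "'v \<Rightarrow> nat"
    and ord :: "'v \<Rightarrow> 'v list" and \<phi> :: "('v \<times> 'v) \<Rightarrow> real mat"
    and gV :: "'v \<Rightarrow> 'u set" and gE :: "'v \<Rightarrow> 'u set set" and gw :: "'v \<Rightarrow> 'u set \<Rightarrow> real"
    and bnd :: "'v \<Rightarrow> 'u list" and M :: "'v \<Rightarrow> real mat"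
  assumes fin: "finite B" "finite W" "finite E"
    and BW: "B \<inter> W = {}" and EBW: "E \<subseteq> B \<times> W"
    and npos: "\<forall>v\<in>B \<union> W. n v > 0"
    and ord_black: "\<forall>b\<in>B. distinct (ord b) \<and> set (ord b) = {w. (b,w) \<in> E}"
    and ord_white: "\<forall>w\<in>W. distinct (ord w) \<and> set (ord w) = {b. (b,w) \<in> E}"
    and phi_dim: "\<forall>(b,w)\<in>E. \<phi> (b,w) \<in> carrier_mat (n w) (n b)"
    and gadget: "\<forall>v\<in>B \<union> W. finite (gV v)
        \<and> (\<forall>e\<in>gE v. \<exists>x y. x \<noteq> y \<and> e = {x,y} \<and> x \<in> gV v \<and> y \<in> gV v)
        \<and> (\<exists>col :: 'u \<Rightarrow> bool. \<forall>e\<in>gE v. \<exists>x y. e = {x,y} \<and> col x \<noteq> col y)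
        \<and> distinct (bnd v) \<and> set (bnd v) \<subseteq> gV v"
    and bnd_white: "\<forall>w\<in>W. length (bnd w) = length (ord w) * n w"
    and bnd_black: "\<forall>b\<in>B. length (bnd b) = sum_list (map n (ord b))"
    and M_white: "\<forall>w\<in>W. M w \<in> carrier_mat (n w) (length (ord w) * n w)"
    and M_black: "\<forall>b\<in>B. M b \<in> carrier_mat (sum_list (map n (ord b))) (n b)"
    and phi_factor: "\<forall>(b,w)\<in>E. \<phi> (b,w) =
        mat (n w) (n w) (\<lambda>(i,j). M w $$ (i, edge_idx (ord w) b * n w + j))
        * mat (n w) (n b) (\<lambda>(i,j). M b $$ (blk_off n (ord b) w + i, j))"
    and minors_black: "\<forall>b\<in>B. \<forall>I. I \<subseteq> {..<length (bnd b)} \<and> card I = n b \<longrightarrow>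
        gadget_sum gV gE gw bnd b I = det (submatrix (M b) I {..<n b})"
    and minors_white: "\<forall>w\<in>W. \<forall>J. J \<subseteq> {..<length (bnd w)} \<and> card J = n w \<longrightarrow>
        gadget_sum gV gE gw bnd w J = det (submatrix (M w) {..<n w} J)"
    and m_web: "m \<in> multiwebs B W E n"
  shows "(\<Sum>\<pi> \<in> {\<pi> \<in> dimer_covers (hat_V B W gV) (inner_edges B W gE \<union> middle_edges E n ord bnd).
              m_of_pi E n ord bnd \<pi> = m}.
           \<Prod>e\<in>\<pi>. hat_wt gw e)
         = trace_Phi B W E n ord \<phi> m"
proof -
  define p where "p v e i = (if v \<in> B then blk_off n (ord v) (snd e) + i
     else blk_off (\<lambda>_. n v) (ord v) (fst e) + i)" for v :: 'v and e :: "'v \<times> 'v" and i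
  have ord: "distinct (ord v)" if "v \<in> B \<union> W" for v using that ord_black ord_white by blast
  have setB: "set (ord b) = {w. (b,w) \<in> E}" if "b \<in> B" for b using that ord_black by blast
  have setW: "set (ord w) = {b. (b,w) \<in> E}" if "w \<in> W" for w using that ord_white by blast
  have WB: "w \<notin> B" if "w \<in> W" for w using that BW by blast
  have lenW: "length (bnd w) = sum_list (map (\<lambda>_. n w) (ord w))" if "w \<in> W" for w
    using that bnd_white by (simp add: sum_list_triv)

  interpret G: glued_gadgets B W E fst snd n p gV gE gw bnd
  proof
    show "finite B" "finite W" "finite E" "B \<inter> W = {}" by (fact fin BW)+
    show "fst e \<in> B" "snd e \<in> W" if "e \<in> E" for e using that EBW by auto
    fix v assume v: "v \<in> B \<union> W"
    show "bij_betw (\<lambda>(e, i). p v e i) (SIGMA e:{e \<in> E. v = fst e \<or> v = snd e}. {..<n (snd e)})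
        {..<length (bnd v)}"
    proof (cases "v \<in> B")
      case True
      let ?D = "SIGMA e:{e \<in> E. v = fst e \<or> v = snd e}. {..<n (snd e)}"
      \<comment> \<open>An edge at v is determined by its other end, so the enumeration of positions
        reduces to \<open>bij_betw_blk_off\<close>.\<close>
      have "bij_betw (\<lambda>(e, i). (snd e, i)) ?D (SIGMA u:set (ord v). {..<n u})"
        by (rule bij_betwI[of _ _ _ "\<lambda>(u, i). ((v, u), i)"]) (use True BW EBW setB in auto)
      from bij_betw_trans[OF this bij_betw_blk_off[OF ord[OF v], of n]]
      have "bij_betw ((\<lambda>(u,i). blk_off n (ord v) u + i) \<circ> (\<lambda>(e, i). (snd e, i))) ?D {..<length (bnd v)}"
        using bnd_black True by simp
      then show ?thesis
        by (rule bij_betw_cong[THEN iffD1, rotated]) (use True in \<open>auto simp: p_def\<close>)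
    next
      case False
      then have w: "v \<in> W" using v by simp
      let ?D = "SIGMA e:{e \<in> E. v = fst e \<or> v = snd e}. {..<n (snd e)}"
      have "bij_betw (\<lambda>(e, i). (fst e, i)) ?D (SIGMA u:set (ord v). {..<n v})"
        by (rule bij_betwI[of _ _ _ "\<lambda>(u, i). ((u, v), i)"]) (use w BW EBW setW in auto)
      from bij_betw_trans[OF this bij_betw_blk_off[OF ord[OF v], of "\<lambda>_. n v"]]
      have "bij_betw ((\<lambda>(u,i). blk_off (\<lambda>_. n v) (ord v) u + i) \<circ> (\<lambda>(e, i). (fst e, i))) ?D {..<length (bnd v)}"
        using lenW[OF w] by simp
      then show ?thesis
        by (rule bij_betw_cong[THEN iffD1, rotated]) (use False in \<open>auto simp: p_def\<close>)
    qed
    show "finite (gV v)" "distinct (bnd v)" using gadget v by blast+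
    fix f assume "f \<in> gE v"
    then obtain x y where "f = {x, y}" "x \<in> gV v" "y \<in> gV v" using gadget v by metis
    then show "f \<subseteq> gV v" "f \<noteq> {}" by simp_all
  qed

  have mid: "mid_edge n ord bnd b w i = G.mid (b, w) i" if "(b, w) \<in> E" for b w i
    using that EBW WB by (auto simp: mid_edge_def G.mid_def p_def blk_off_const)
  have mids: "middle_edges E n ord bnd = G.mids"
    unfolding middle_edges_def G.mids_def using mid by fastforce
  \<comment> \<open>Off \<open>E\<close>, \<open>m_of_pi\<close> is 0 by definition, so equality
    with \<open>m\<close> only has to be compared on \<open>E\<close>.\<close>
  have m0: "m e = 0" if "e \<notin> E" for e using that m_web unfolding multiwebs_def by blast
  have m_of: "m_of_pi E n ord bnd \<pi> = m \<longleftrightarrow> (\<forall>e\<in>E. card (G.free \<pi> e) = m e)" for \<pi>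
  proof -
    have "m_of_pi E n ord bnd \<pi> e = (if e \<in> E then card (G.free \<pi> e) else 0)" for e
    proof (cases e)
      case (Pair b w)
      then show ?thesis by (simp add: m_of_pi_def G.free_def mid)
    qed
    then show ?thesis using m0 by (auto simp: fun_eq_iff)
  qed

  \<comment> \<open>Fixing the sizes edge by edge leaves a product set, which lets the sum over
    \<open>U\<close> factor over the edges.\<close>
  define C where "C e = {U. U \<subseteq> {..<n (snd e)} \<and> card U = m e}" for e :: "'v \<times> 'v"
  have finC: "finite (C e)" for e unfolding C_def by simp
  have slots: "{U \<in> G.slots. \<forall>e\<in>E. card (U e) = m e} = PiE E C"
    by (auto simp: C_def PiE_def Pi_def)
  have U_bound: "U e \<subseteq> {..<n (snd e)}" "card (U e) = m e" if "U \<in> PiE E C" "e \<in> E" for U e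
    using PiE_mem[OF that] unfolding C_def by simp_all

  \<comment> \<open>\<open>Q\<close> and \<open>P\<close> are the contributions of the black and the
    white end of an edge. In \<open>P\<close> the column index of \<open>M\<close> comes first,
    since white blocks consist of columns.\<close>
  define Q where "Q e U S = lminor (\<lambda>i j. M (fst e) $$ (blk_off n (ord (fst e)) (snd e) + i, j))
     (sorted_list_of_set U) S" for e :: "'v \<times> 'v" and U S
  define P where "P e U T = lminor (\<lambda>j i. M (snd e) $$ (i, blk_off (\<lambda>_. n (snd e)) (ord (snd e)) (fst e) + j))
     (sorted_list_of_set U) T" for e :: "'v \<times> 'v" and U T

  let ?S = "half_colorings B E (\<lambda>b. {w. (b,w) \<in> E}) (\<lambda>b w. (b,w)) n m"
  let ?T = "half_colorings W E (\<lambda>w. {b. (b,w) \<in> E}) (\<lambda>w b. (b,w)) n m"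
  let ?cB = "\<lambda>S. \<Prod>b\<in>B. list_sign (concat (map (\<lambda>w. sorted_list_of_set (S (b,w))) (ord b)))"
  let ?cW = "\<lambda>T. \<Prod>w\<in>W. list_sign (concat (map (\<lambda>b. sorted_list_of_set (T (b,w))) (ord w)))"

  have black: "gadget_sum gV gE gw bnd b (G.used b U) =
     (\<Sum>s\<in>set_parts {w. (b,w) \<in> E} (\<lambda>w. m (b,w)) {..<n b}.
        list_sign (concat (map (\<lambda>w. sorted_list_of_set (s w)) (ord b)))
        * (\<Prod>w\<in>{w. (b,w) \<in> E}. Q (b,w) (U (b,w)) (s w)))"
    if b: "b \<in> B" and U: "U \<in> PiE E C" for b U
  proof -
    let ?I = "\<Union>w\<in>set (ord b). (+) (blk_off n (ord b) w) ` U (b,w)"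
    have inc: "G.inc b = Pair b ` set (ord b)"
      using b setB[OF b] EBW BW by (auto simp: G.inc_def)
    have "p b (b,w) = (+) (blk_off n (ord b) w)" for w using b by (simp add: p_def fun_eq_iff)
    then have used: "G.used b U = ?I" by (simp add: G.used_def inc)
    have sub: "U (b,w) \<subseteq> {..<n w}" and cardU: "card (U (b,w)) = m (b,w)" if "w \<in> set (ord b)" for w
      using U_bound[OF U, of "(b,w)"] that setB[OF b] by simp_all
    have d: "distinct (ord b)" using ord b by simp
    \<comment> \<open>The multiweb condition at b gives the index set the size \<open>n b\<close>
      that \<open>minors_black\<close> demands.\<close>
    have "card ?I = (\<Sum>w\<in>set (ord b). m (b,w))"
      using card_blocks[OF d sub] cardU by simp
    also have "\<dots> = n b" using m_web b setB[OF b] by (simp add: multiwebs_def)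
    finally have card: "card ?I = n b" .
    have bound: "?I \<subseteq> {..<sum_list (map n (ord b))}" by (rule blocks_subset[OF d sub])
    have "gadget_sum gV gE gw bnd b (G.used b U) = det (submatrix (M b) ?I {..<n b})"
      using minors_black b bound card bnd_black by (simp add: used)
    also have "\<dots> = lminor (\<lambda>i j. M b $$ (i, j)) (sorted_list_of_set ?I) {..<n b}"
      using M_black b bound card by (intro det_submatrix_eq_lminor) auto
    also have "\<dots> = (\<Sum>s\<in>set_parts (set (ord b)) (\<lambda>w. card (U (b,w))) {..<n b}.
        list_sign (concat (map (\<lambda>w. sorted_list_of_set (s w)) (ord b)))
        * (\<Prod>w\<in>set (ord b). Q (b,w) (U (b,w)) (s w)))"
      unfolding Q_def fst_conv snd_conv by (rule lminor_blocks[OF d sub])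
    also have "set_parts (set (ord b)) (\<lambda>w. card (U (b,w))) {..<n b}
        = set_parts {w. (b,w) \<in> E} (\<lambda>w. m (b,w)) {..<n b}"
      using cardU setB[OF b] unfolding set_parts_def by auto
    finally show ?thesis unfolding setB[OF b] .
  qed

  have white: "gadget_sum gV gE gw bnd w (G.used w U) =
     (\<Sum>s\<in>set_parts {b. (b,w) \<in> E} (\<lambda>b. m (b,w)) {..<n w}.
        list_sign (concat (map (\<lambda>b. sorted_list_of_set (s b)) (ord w)))
        * (\<Prod>b\<in>{b. (b,w) \<in> E}. P (b,w) (U (b,w)) (s b)))"
    if w: "w \<in> W" and U: "U \<in> PiE E C" for w U
  proof -
    let ?k = "\<lambda>_::'v. n w"
    let ?J = "\<Union>b\<in>set (ord w). (+) (blk_off ?k (ord w) b) ` U (b,w)"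
    have inc: "G.inc w = (\<lambda>b. (b, w)) ` set (ord w)"
      using w setW[OF w] EBW BW by (auto simp: G.inc_def)
    have "p w (b,w) = (+) (blk_off ?k (ord w) b)" for b using WB[OF w] by (simp add: p_def fun_eq_iff)
    then have used: "G.used w U = ?J" by (simp add: G.used_def inc)
    have sub: "U (b,w) \<subseteq> {..<?k b}" and cardU: "card (U (b,w)) = m (b,w)" if "b \<in> set (ord w)" for b
      using U_bound[OF U, of "(b,w)"] that setW[OF w] by simp_all
    have d: "distinct (ord w)" using ord w by simp
    have "card ?J = (\<Sum>b\<in>set (ord w). m (b,w))"
      using card_blocks[OF d sub] cardU by simp
    also have "\<dots> = n w" using m_web w setW[OF w] by (simp add: multiwebs_def)
    finally have card: "card ?J = n w" .
    have bound: "?J \<subseteq> {..<sum_list (map ?k (ord w))}" by (rule blocks_subset[OF d sub])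
    have Mw: "M w \<in> carrier_mat (n w) (sum_list (map ?k (ord w)))"
      using M_white w by (simp add: sum_list_triv)
    have finJ: "finite ?J" using bound finite_subset by blast
    have "gadget_sum gV gE gw bnd w (G.used w U) = det (submatrix (M w) {..<n w} ?J)"
      using minors_white w bound card lenW[OF w] by (simp add: used)
    also have "\<dots> = lminor (\<lambda>i j. M w $$ (i, j)) (sorted_list_of_set {..<n w}) ?J"
      using Mw bound card by (intro det_submatrix_eq_lminor) auto
    \<comment> \<open>Transposing turns the blocks of columns into blocks of listed rows.\<close>
    also have "\<dots> = lminor (\<lambda>j i. M w $$ (i, j)) (sorted_list_of_set ?J) {..<n w}"
      using card finJ by (intro lminor_transpose) auto
    also have "\<dots> = (\<Sum>s\<in>set_parts (set (ord w)) (\<lambda>b. card (U (b,w))) {..<n w}.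
        list_sign (concat (map (\<lambda>b. sorted_list_of_set (s b)) (ord w)))
        * (\<Prod>b\<in>set (ord w). P (b,w) (U (b,w)) (s b)))"
      unfolding P_def fst_conv snd_conv by (rule lminor_blocks[OF d sub])
    also have "set_parts (set (ord w)) (\<lambda>b. card (U (b,w))) {..<n w}
        = set_parts {b. (b,w) \<in> E} (\<lambda>b. m (b,w)) {..<n w}"
      using cardU setW[OF w] unfolding set_parts_def by auto
    finally show ?thesis unfolding setW[OF w] .
  qed

  have prod_black: "(\<Prod>b\<in>B. gadget_sum gV gE gw bnd b (G.used b U))
      = (\<Sum>S\<in>?S. ?cB S * (\<Prod>e\<in>E. Q e (U e) (S e)))" if U: "U \<in> PiE E C" for U
  proof -
    have "(\<Prod>b\<in>B. gadget_sum gV gE gw bnd b (G.used b U))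
        = (\<Prod>b\<in>B. \<Sum>s\<in>set_parts {w. (b,w) \<in> E} (\<lambda>w. m (b,w)) {..<n b}.
        list_sign (concat (map (\<lambda>w. sorted_list_of_set (s w)) (ord b)))
        * (\<Prod>w\<in>{w. (b,w) \<in> E}. Q (b,w) (U (b,w)) (s w)))"
      by (rule prod.cong[OF refl]) (rule black[OF _ U])
    also have "\<dots> = (\<Sum>S\<in>?S. ?cB S * (\<Prod>e\<in>E. Q e (U e) (S e)))"
      by (rule prod_half_colorings[where fr = fst and ot = snd and h = "\<lambda>e. Q e (U e)"])
        (use fin setB EBW in auto)
    finally show ?thesis .
  qed
  have prod_white: "(\<Prod>w\<in>W. gadget_sum gV gE gw bnd w (G.used w U))
      = (\<Sum>T\<in>?T. ?cW T * (\<Prod>e\<in>E. P e (U e) (T e)))" if U: "U \<in> PiE E C" for U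
  proof -
    have "(\<Prod>w\<in>W. gadget_sum gV gE gw bnd w (G.used w U))
        = (\<Prod>w\<in>W. \<Sum>s\<in>set_parts {b. (b,w) \<in> E} (\<lambda>b. m (b,w)) {..<n w}.
        list_sign (concat (map (\<lambda>b. sorted_list_of_set (s b)) (ord w)))
        * (\<Prod>b\<in>{b. (b,w) \<in> E}. P (b,w) (U (b,w)) (s b)))"
      by (rule prod.cong[OF refl]) (rule white[OF _ U])
    also have "\<dots> = (\<Sum>T\<in>?T. ?cW T * (\<Prod>e\<in>E. P e (U e) (T e)))"
      by (rule prod_half_colorings[where fr = snd and ot = fst and mk = "\<lambda>w b. (b,w)" and h = "\<lambda>e. P e (U e)"])
        (use fin setW EBW in auto)
    finally show ?thesis .
  qed

  have edge: "(\<Prod>e\<in>{e\<in>E. m e > 0}. det (submatrix (\<phi> e) (T e) (S e)))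
      = (\<Sum>U\<in>PiE E C. \<Prod>e\<in>E. P e (U e) (T e) * Q e (U e) (S e))"
    if S: "S \<in> ?S" and T: "T \<in> ?T" for S T
  proof -
    have ST: "S e \<subseteq> {..<n (fst e)}" "card (S e) = m e" "T e \<subseteq> {..<n (snd e)}" "card (T e) = m e"
      if "e \<in> E" for e
    proof -
      obtain b w where e: "e = (b, w)" by (cases e)
      then have "b \<in> B" "w \<in> W" using that EBW by auto
      then show "S e \<subseteq> {..<n (fst e)}" "card (S e) = m e" "T e \<subseteq> {..<n (snd e)}" "card (T e) = m e"
        using S T that e unfolding half_colorings_def restrict_mem_set_parts_iff by simp_all
    qed
    have det: "det (submatrix (\<phi> e) (T e) (S e)) = (\<Sum>U\<in>C e. P e U (T e) * Q e U (S e))"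
      if e: "e \<in> E" for e
    proof -
      let ?b = "fst e" and ?w = "snd e"
      let ?A = "mat (n ?w) (n ?w) (\<lambda>(i,j). M ?w $$ (i, edge_idx (ord ?w) ?b * n ?w + j))"
      let ?B = "mat (n ?w) (n ?b) (\<lambda>(i,j). M ?b $$ (blk_off n (ord ?b) ?w + i, j))"
      have phi: "\<phi> e = ?A * ?B" using phi_factor e by (cases e) auto
      have "det (submatrix (\<phi> e) (T e) (S e)) = (\<Sum>U\<in>C e.
         lminor (\<lambda>j i. ?A $$ (i, j)) (sorted_list_of_set U) (T e)
         * lminor (\<lambda>i j. ?B $$ (i, j)) (sorted_list_of_set U) (S e))"
        unfolding phi C_def using ST[OF e] by (intro det_submatrix_mult) auto
      also have "\<dots> = (\<Sum>U\<in>C e. P e U (T e) * Q e U (S e))"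
      proof (intro sum.cong refl arg_cong2[of _ _ _ _ "(*)"])
        fix U assume "U \<in> C e"
        then have U: "U \<subseteq> {..<n ?w}" "finite U" using finite_subset unfolding C_def by auto
        have less: "i \<in> U \<Longrightarrow> i < n ?w" "i \<in> T e \<Longrightarrow> i < n ?w" "i \<in> S e \<Longrightarrow> i < n ?b" for i
          using U ST[OF e] by auto
        show "lminor (\<lambda>j i. ?A $$ (i, j)) (sorted_list_of_set U) (T e) = P e U (T e)"
          unfolding P_def using U(2) less by (intro lminor_cong) (simp add: blk_off_const)
        show "lminor (\<lambda>i j. ?B $$ (i, j)) (sorted_list_of_set U) (S e) = Q e U (S e)"
          unfolding Q_def using U(2) less by (intro lminor_cong) simp
      qed
      finally show ?thesis .
    qed
    \<comment> \<open>Edges with \<open>m e = 0\<close> contribute an empty determinant, which is 1,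
      so the product may run over all of \<open>E\<close>.\<close>
    have "(\<Prod>e\<in>{e\<in>E. m e > 0}. det (submatrix (\<phi> e) (T e) (S e)))
        = (\<Prod>e\<in>E. det (submatrix (\<phi> e) (T e) (S e)))"
    proof (rule prod.mono_neutral_left)
      show "\<forall>e\<in>E - {e\<in>E. m e > 0}. det (submatrix (\<phi> e) (T e) (S e)) = 1"
      proof
        fix e assume "e \<in> E - {e\<in>E. m e > 0}"
        then have "e \<in> E" "m e = 0" by auto
        moreover from this have "finite (S e)" "finite (T e)"
          using ST[of e] finite_subset by blast+
        ultimately have "S e = {}" "T e = {}" using ST[of e] by auto
        then show "det (submatrix (\<phi> e) (T e) (S e)) = 1"
          by (intro det_dim_zero) (auto simp: submatrix_def)
      qed
    qed (use fin in auto)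
    also have "\<dots> = (\<Prod>e\<in>E. \<Sum>U\<in>C e. P e U (T e) * Q e U (S e))"
      by (rule prod.cong[OF refl det])
    also have "\<dots> = (\<Sum>U\<in>PiE E C. \<Prod>e\<in>E. P e (U e) (T e) * Q e (U e) (S e))"
      by (rule prod_sum_PiE[OF fin(3) finC])
    finally show ?thesis .
  qed

  have "(\<Sum>\<pi> \<in> {\<pi> \<in> dimer_covers (hat_V B W gV) (inner_edges B W gE \<union> middle_edges E n ord bnd).
              m_of_pi E n ord bnd \<pi> = m}. \<Prod>e\<in>\<pi>. hat_wt gw e)
      = (\<Sum>U\<in>PiE E C. \<Prod>v\<in>B \<union> W. gadget_sum gV gE gw bnd v (G.used v U))"
    unfolding mids m_of by (subst G.sum_dimer_covers, subst slots, rule refl)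
  also have "\<dots> = (\<Sum>U\<in>PiE E C. (\<Prod>b\<in>B. gadget_sum gV gE gw bnd b (G.used b U))
      * (\<Prod>w\<in>W. gadget_sum gV gE gw bnd w (G.used w U)))"
    by (intro sum.cong refl prod.union_disjoint fin BW)
  also have "\<dots> = (\<Sum>U\<in>PiE E C. \<Sum>S\<in>?S. \<Sum>T\<in>?T.
      (?cB S * (\<Prod>e\<in>E. Q e (U e) (S e))) * (?cW T * (\<Prod>e\<in>E. P e (U e) (T e))))"
    by (intro sum.cong refl) (simp only: prod_black prod_white sum_product)
  \<comment> \<open>For a fixed colouring the summand depends on \<open>U\<close> edge by edge, so
    the sum over \<open>U\<close> moves innermost, where \<open>edge\<close> evaluates it.\<close>
  also have "\<dots> = (\<Sum>S\<in>?S. \<Sum>T\<in>?T. \<Sum>U\<in>PiE E C.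
      (?cB S * (\<Prod>e\<in>E. Q e (U e) (S e))) * (?cW T * (\<Prod>e\<in>E. P e (U e) (T e))))"
    by (subst sum.swap) (intro sum.cong refl sum.swap)
  also have "\<dots> = (\<Sum>S\<in>?S. \<Sum>T\<in>?T. ?cB S * ?cW T
      * (\<Prod>e\<in>{e\<in>E. m e > 0}. det (submatrix (\<phi> e) (T e) (S e))))"
    by (intro sum.cong refl) (simp only: edge sum_distrib_left prod.distrib mult_ac)
  also have "\<dots> = trace_Phi B W E n ord \<phi> m"
    unfolding trace_Phi_def colorings_eq_Times[OF EBW] by (rule sum.cartesian_product)
  finally show ?thesis .
qed

end
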